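(* Let $q\ge 2$ be an integer and let $\mathcal{A}$ be the adjacency matrix on the $(q+1)$-regular tree $\mathbb{T}_q$. For any vertices $v,w\in\mathbb{T}_q$ with $d(v,w)=n$, as $t\to\infty$, \[ e^{it\mathcal{A}}(v,w)=\begin{cases}\dfrac{1}{\sqrt{\pi}\,t^{3/2}}\sin\left(2\sqrt{q}\,t-\frac{\pi}{4}\right)\cdot\dfrac{q^{-\frac n2+\frac14}\,(2+(n+1)(q-1))}{(q-1)^2}+O(t^{-2}) & \text{if } n \text{ is even},\\[3mm] \dfrac{-i}{\sqrt{\pi}\,t^{3/2}}\sin\left(2\sqrt{q}\,t+\frac{\pi}{4}\right)\cdot\dfrac{q^{-\frac n2+\frac14}\,(2+(n+1)(q-1))}{(q-1)^2}+O(t^{-2}) & \text{if } n \text{ is odd},\end{cases} \] where the term $O(t^{-2})$ is uniform in $n=d(v,w)$ and independent of $v,w$. In particular, there exist $t_0$ and $C_q$ such that for all $t>t_0$ and all $f\in L^1(\mathbb{T}_q)$, \[ \|e^{it\mathcal{A}}f\|_\infty\le\frac{C_q}{t^{3/2}}\|f\|_1 . \]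
   Context: $\mathbb{T}_q$ is the infinite $(q+1)$-regular tree: the connected graph without cycles in which every vertex has exactly $q+1$ neighbors. $d(v,w)$ is the graph distance between vertices. The adjacency matrix is the bounded self-adjoint operator $(\mathcal{A}f)(v)=\sum_{w\sim v}f(w)$ on $\ell^2(\mathbb{T}_q)$ (functions on the vertex set, counting measure), the sum running over the nearest neighbors $w$ of $v$. $e^{it\mathcal{A}}(v,w)=\langle\delta_v,e^{it\mathcal{A}}\delta_w\rangle$ denotes the matrix element of the evolution operator. $L^1(\mathbb{T}_q)$ is the space of summable functions on the vertices, with norm $\|f\|_1=\sum_v|f(v)|$, and $\|f\|_\infty=\sup_v|f(v)|$. *)

theory Defs
  imports "HOL-Analysis.Analysis"
begin

section \<open>The regular tree\<close>

text \<open>A simple graph on the vertex set \<open>UNIV :: 'v set\<close> is given by its adjacency relation.\<close>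

definition graph_cycle :: "('v \<Rightarrow> 'v \<Rightarrow> bool) \<Rightarrow> 'v list \<Rightarrow> bool" where
  "graph_cycle E xs \<longleftrightarrow>
     length xs \<ge> 3 \<and> distinct xs \<and> successively E xs \<and> E (last xs) (hd xs)"

locale regular_tree =
  fixes q :: nat and E :: "'v \<Rightarrow> 'v \<Rightarrow> bool"
  assumes adj_sym: "E v w \<Longrightarrow> E w v"
    and adj_irrefl: "\<not> E v v"
    and connected: "E\<^sup>*\<^sup>* v w"
    and acyclic: "\<not> graph_cycle E xs"
    and card_nbrs: "card {w. E v w} = q + 1"

lemma (in regular_tree) finite_nbrs: "finite {w. E v w}"
  by (rule card_ge_0_finite) (simp add: card_nbrs)

text \<open>\<open>(E ^^ n) v w\<close> says that there is a walk of length \<open>n\<close> from \<open>v\<close> to \<open>w\<close>.\<close>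

definition graph_dist :: "('v \<Rightarrow> 'v \<Rightarrow> bool) \<Rightarrow> 'v \<Rightarrow> 'v \<Rightarrow> nat" where
  "graph_dist E v w = (LEAST n. (E ^^ n) v w)"


section \<open>The Hilbert space of square-summable functions\<close>

definition square_summable :: "('a \<Rightarrow> complex) \<Rightarrow> bool" where
  "square_summable f \<longleftrightarrow> (\<lambda>x. (cmod (f x))\<^sup>2) summable_on UNIV"

lemma square_summable_mult:
  assumes "square_summable f" "square_summable g"
  shows "(\<lambda>x. cmod (f x) * cmod (g x)) summable_on UNIV"
proof (rule summable_on_comparison_test)
  show "(\<lambda>x. (cmod (f x))\<^sup>2 + (cmod (g x))\<^sup>2) summable_on UNIV"
    using assms unfolding square_summable_def by (rule summable_on_add)
  show "cmod (f x) * cmod (g x) \<le> (cmod (f x))\<^sup>2 + (cmod (g x))\<^sup>2" for x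
  proof -
    have "0 \<le> cmod (f x) * cmod (g x)" by simp
    then show ?thesis
      using sum_squares_bound[of "cmod (f x)" "cmod (g x)"] by linarith
  qed
qed simp

lemma square_summable_add:
  assumes "square_summable f" "square_summable g"
  shows "square_summable (\<lambda>x. f x + g x)"
  unfolding square_summable_def
proof (rule summable_on_comparison_test)
  show "(\<lambda>x. 2 * (cmod (f x))\<^sup>2 + 2 * (cmod (g x))\<^sup>2) summable_on UNIV"
    using assms unfolding square_summable_def
    by (intro summable_on_add summable_on_cmult_right)
  show "(cmod (f x + g x))\<^sup>2 \<le> 2 * (cmod (f x))\<^sup>2 + 2 * (cmod (g x))\<^sup>2" for x
  proof -
    have "(cmod (f x + g x))\<^sup>2 \<le> (cmod (f x) + cmod (g x))\<^sup>2"
      by (intro power_mono norm_triangle_ineq) simp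
    also have "\<dots> \<le> 2 * (cmod (f x))\<^sup>2 + 2 * (cmod (g x))\<^sup>2"
      using sum_squares_bound[of "cmod (f x)" "cmod (g x)"] by (simp add: power2_sum)
    finally show ?thesis .
  qed
qed simp

lemma square_summable_cmult:
  assumes "square_summable f"
  shows "square_summable (\<lambda>x. c * f x)"
  using assms summable_on_cmult_right[of "\<lambda>x. (cmod (f x))\<^sup>2" UNIV "(cmod c)\<^sup>2"]
  unfolding square_summable_def by (simp add: norm_mult power_mult_distrib)

lemma square_summable_diff:
  assumes "square_summable f" "square_summable g"
  shows "square_summable (\<lambda>x. f x - g x)"
  using square_summable_add[OF assms(1) square_summable_cmult[OF assms(2), of "- 1"]] by simp

lemma square_summable_finite_support:
  assumes "finite {x. f x \<noteq> 0}"
  shows "square_summable f"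
proof -
  have "(\<lambda>x. (cmod (f x))\<^sup>2) summable_on {x. f x \<noteq> 0}"
    using assms by (rule summable_on_finite)
  then show ?thesis
    unfolding square_summable_def
    by (subst summable_on_cong_neutral[of "{x. f x \<noteq> 0}"]) auto
qed

lemma abs_summable_imp_square_summable:
  assumes "(\<lambda>v. cmod (f v)) summable_on UNIV"
  shows "square_summable f"
  unfolding square_summable_def
proof (rule summable_on_comparison_test)
  let ?S = "\<Sum>\<^sub>\<infinity>x. cmod (f x)"
  show "(\<lambda>x. ?S * cmod (f x)) summable_on UNIV"
    using assms by (rule summable_on_cmult_right)
  show "(cmod (f x))\<^sup>2 \<le> ?S * cmod (f x)" for x
    using finite_sum_le_infsum[OF assms, of "{x}"]
    by (simp add: power2_eq_square mult_right_mono)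
qed simp

typedef 'a ell2 = "Collect square_summable :: ('a \<Rightarrow> complex) set"
  morphisms ell2_fun Ell2
  by (rule exI[of _ "\<lambda>_. 0"]) (simp add: square_summable_def)

setup_lifting type_definition_ell2

lemma square_summable_ell2_fun: "square_summable (ell2_fun f)"
  using ell2_fun[of f] by simp

lemma ell2_fun_Ell2: "square_summable f \<Longrightarrow> ell2_fun (Ell2 f) = f"
  by (simp add: Ell2_inverse)

lift_definition scaleC_ell2 :: "complex \<Rightarrow> 'a ell2 \<Rightarrow> 'a ell2" is "\<lambda>c f x. c * f x"
  by (simp add: square_summable_cmult)

lift_definition cinner_ell2 :: "'a ell2 \<Rightarrow> 'a ell2 \<Rightarrow> complex" is
  "\<lambda>f g. \<Sum>\<^sub>\<infinity>x. cnj (f x) * g x" .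

lift_definition delta_ell2 :: "'a \<Rightarrow> 'a ell2" is "\<lambda>v x. if x = v then 1 else 0"
  by (simp add: square_summable_finite_support)

lemma cinner_delta_ell2: "cinner_ell2 (delta_ell2 v) f = ell2_fun f v"
proof transfer
  fix v :: 'a and f :: "'a \<Rightarrow> complex"
  have "(\<Sum>\<^sub>\<infinity>x. cnj (if x = v then 1 else 0) * f x) = (\<Sum>\<^sub>\<infinity>x\<in>{v}. f x)"
    by (rule infsum_cong_neutral) auto
  then show "(\<Sum>\<^sub>\<infinity>x. cnj (if x = v then 1 else 0) * f x) = f v" by simp
qed

instantiation ell2 :: (type) real_vector
begin

lift_definition zero_ell2 :: "'a ell2" is "\<lambda>_. 0"
  by (simp add: square_summable_def)

lift_definition plus_ell2 :: "'a ell2 \<Rightarrow> 'a ell2 \<Rightarrow> 'a ell2" is "\<lambda>f g x. f x + g x"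
  by (simp add: square_summable_add)

lift_definition uminus_ell2 :: "'a ell2 \<Rightarrow> 'a ell2" is "\<lambda>f x. - f x"
  by (simp add: square_summable_def)

lift_definition minus_ell2 :: "'a ell2 \<Rightarrow> 'a ell2 \<Rightarrow> 'a ell2" is "\<lambda>f g x. f x - g x"
  by (simp add: square_summable_diff)

lift_definition scaleR_ell2 :: "real \<Rightarrow> 'a ell2 \<Rightarrow> 'a ell2" is "\<lambda>r f x. r *\<^sub>R f x"
  by (simp add: square_summable_cmult scaleR_conv_of_real)

instance
  by standard (transfer; simp add: fun_eq_iff algebra_simps)+

end

text \<open>The real inner product is the real part of the complex one; both have the same norm.\<close>

instantiation ell2 :: (type) real_inner
begin

definition inner_ell2 :: "'a ell2 \<Rightarrow> 'a ell2 \<Rightarrow> real" where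
  "inner_ell2 f g = Re (cinner_ell2 f g)"

lift_definition norm_ell2 :: "'a ell2 \<Rightarrow> real" is "\<lambda>f. sqrt (\<Sum>\<^sub>\<infinity>x. (cmod (f x))\<^sup>2)" .

definition dist_ell2 :: "'a ell2 \<Rightarrow> 'a ell2 \<Rightarrow> real" where
  "dist_ell2 f g = norm (f - g)"

definition sgn_ell2 :: "'a ell2 \<Rightarrow> 'a ell2" where
  "sgn_ell2 f = f /\<^sub>R norm f"

definition uniformity_ell2 :: "('a ell2 \<times> 'a ell2) filter" where
  "uniformity_ell2 = (INF e\<in>{0<..}. principal {(x, y). dist x y < e})"

definition open_ell2 :: "'a ell2 set \<Rightarrow> bool" where
  "open_ell2 U \<longleftrightarrow> (\<forall>x\<in>U. \<forall>\<^sub>F (x', y) in uniformity. x' = x \<longrightarrow> y \<in> U)"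

lemma cinner_summable:
  "(\<lambda>x. cnj (ell2_fun f x) * ell2_fun g x) summable_on UNIV"
  using square_summable_mult[OF square_summable_ell2_fun[of f] square_summable_ell2_fun[of g]]
  by - (rule abs_summable_summable, simp add: norm_mult)

lemma inner_ell2_altdef:
  "inner f g = (\<Sum>\<^sub>\<infinity>x. ell2_fun f x \<bullet> ell2_fun g x)"
  unfolding inner_ell2_def cinner_ell2.rep_eq
  by (subst infsum_Re[OF cinner_summable, symmetric]) (simp add: inner_complex_def)

lemma inner_ell2_summable:
  "(\<lambda>x. ell2_fun f x \<bullet> ell2_fun g x) summable_on UNIV"
  using summable_on_Re[OF cinner_summable[of f g]] by (simp add: inner_complex_def)

instance
proof
  fix f g h :: "'a ell2" and r :: real
  show "dist f g = norm (f - g)" by (rule dist_ell2_def)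
  show "sgn f = f /\<^sub>R norm f" by (rule sgn_ell2_def)
  show "uniformity = (INF e\<in>{0<..}. principal {(x, y). dist x (y::'a ell2) < e})"
    by (rule uniformity_ell2_def)
  show "open U \<longleftrightarrow> (\<forall>x\<in>U. \<forall>\<^sub>F (x', y) in uniformity. x' = x \<longrightarrow> y \<in> U)" for U :: "'a ell2 set"
    by (rule open_ell2_def)
  show "inner f g = inner g f" by (simp add: inner_ell2_altdef inner_commute)
  show "inner (f + g) h = inner f h + inner g h"
    unfolding inner_ell2_altdef plus_ell2.rep_eq inner_add_left
    by (intro infsum_add inner_ell2_summable)
  show "inner (r *\<^sub>R f) g = r * inner f g"
    unfolding inner_ell2_altdef scaleR_ell2.rep_eq inner_scaleR_left
    by (intro infsum_cmult_right inner_ell2_summable)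
  show "0 \<le> inner f f" by (simp add: inner_ell2_altdef infsum_nonneg)
  show "inner f f = 0 \<longleftrightarrow> f = 0"
  proof
    assume "inner f f = 0"
    then have "ell2_fun f x \<bullet> ell2_fun f x = 0" for x
      using nonneg_infsum_le_0D[OF _ inner_ell2_summable[of f f], of x]
      by (simp add: inner_ell2_altdef)
    then show "f = 0"
      by (simp add: ell2_fun_inject[symmetric] zero_ell2.rep_eq fun_eq_iff)
  next
    assume "f = 0"
    then show "inner f f = 0" by (simp add: inner_ell2_altdef zero_ell2.rep_eq)
  qed
  show "norm f = sqrt (inner f f)"
    by (simp add: inner_ell2_altdef norm_ell2.rep_eq power2_norm_eq_inner)
qed

end

lemma norm_ell2_sq: "(norm f)\<^sup>2 = (\<Sum>\<^sub>\<infinity>x. (cmod (ell2_fun f x))\<^sup>2)"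
  by (simp add: norm_ell2.rep_eq infsum_nonneg)

lemma finite_sum_le_norm_ell2:
  assumes "finite F"
  shows "(\<Sum>x\<in>F. (cmod (ell2_fun f x))\<^sup>2) \<le> (norm f)\<^sup>2"
  unfolding norm_ell2_sq
  by (rule finite_sum_le_infsum)
     (use assms square_summable_ell2_fun[of f] in \<open>auto simp: square_summable_def\<close>)

lemma cmod_ell2_fun_le_norm: "cmod (ell2_fun f x) \<le> norm f"
  using finite_sum_le_norm_ell2[of "{x}" f] by (auto intro: power2_le_imp_le)

lemma square_summableI:
  assumes "\<And>F. finite F \<Longrightarrow> (\<Sum>x\<in>F. (cmod (f x))\<^sup>2) \<le> B\<^sup>2" and "B \<ge> 0"
  shows "square_summable f" and "norm (Ell2 f) \<le> B"
proof -
  show *: "square_summable f"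
    unfolding square_summable_def
    by (rule nonneg_bdd_above_summable_on) (auto intro!: bdd_aboveI2 assms(1))
  then have "(\<Sum>\<^sub>\<infinity>x. (cmod (f x))\<^sup>2) \<le> B\<^sup>2"
    unfolding square_summable_def by (rule infsum_le_finite_sums) (rule assms(1))
  then have "(norm (Ell2 f))\<^sup>2 \<le> B\<^sup>2"
    using * by (simp add: norm_ell2_sq ell2_fun_Ell2)
  then show "norm (Ell2 f) \<le> B" using assms(2) by (rule power2_le_imp_le)
qed

instance ell2 :: (type) banach
proof
  fix X :: "nat \<Rightarrow> 'a ell2"
  assume X: "Cauchy X"
  have ptw: "Cauchy (\<lambda>n. ell2_fun (X n) x)" for x
  proof (rule CauchyI)
    fix e :: real assume "e > 0"
    from CauchyD[OF X this] obtain M where M: "\<forall>m\<ge>M. \<forall>n\<ge>M. norm (X m - X n) < e" by blast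
    have "norm (ell2_fun (X m) x - ell2_fun (X n) x) < e" if "m \<ge> M" "n \<ge> M" for m n
      using cmod_ell2_fun_le_norm[of "X m - X n" x] M that
      by (fastforce simp: minus_ell2.rep_eq)
    then show "\<exists>M. \<forall>m\<ge>M. \<forall>n\<ge>M. norm (ell2_fun (X m) x - ell2_fun (X n) x) < e" by blast
  qed
  define L where "L x = lim (\<lambda>n. ell2_fun (X n) x)" for x
  have L: "(\<lambda>n. ell2_fun (X n) x) \<longlonglongrightarrow> L x" for x
    using ptw[of x] unfolding L_def by (simp add: Cauchy_convergent_iff convergent_LIMSEQ_iff)
  have bound: "(\<Sum>x\<in>F. (cmod (ell2_fun (X m) x - L x))\<^sup>2) \<le> e\<^sup>2"
    if "finite F" "m \<ge> M" and M: "\<forall>m\<ge>M. \<forall>n\<ge>M. norm (X m - X n) < e" for F m M e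
  proof (rule LIMSEQ_le_const2)
    show "(\<lambda>n. \<Sum>x\<in>F. (cmod (ell2_fun (X m) x - ell2_fun (X n) x))\<^sup>2) \<longlonglongrightarrow>
            (\<Sum>x\<in>F. (cmod (ell2_fun (X m) x - L x))\<^sup>2)"
      by (intro tendsto_intros L)
    have "(\<Sum>x\<in>F. (cmod (ell2_fun (X m) x - ell2_fun (X n) x))\<^sup>2) \<le> e\<^sup>2" if "n \<ge> M" for n
    proof -
      have "(\<Sum>x\<in>F. (cmod (ell2_fun (X m) x - ell2_fun (X n) x))\<^sup>2) \<le> (norm (X m - X n))\<^sup>2"
        using finite_sum_le_norm_ell2[OF \<open>finite F\<close>, of "X m - X n"]
        by (simp add: minus_ell2.rep_eq)
      also have "\<dots> \<le> e\<^sup>2"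
        using M \<open>m \<ge> M\<close> \<open>n \<ge> M\<close> by (intro power_mono) (auto intro: less_imp_le)
      finally show ?thesis .
    qed
    then show "\<exists>N. \<forall>n\<ge>N. (\<Sum>x\<in>F. (cmod (ell2_fun (X m) x - ell2_fun (X n) x))\<^sup>2) \<le> e\<^sup>2"
      by blast
  qed
  have "square_summable L"
  proof -
    obtain M where M: "\<forall>m\<ge>M. \<forall>n\<ge>M. norm (X m - X n) < 1" using CauchyD[OF X, of 1] by auto
    have "square_summable (\<lambda>x. ell2_fun (X M) x - L x)"
      by (rule square_summableI(1)[where B = 1]) (use bound[OF _ _ M] in auto)
    then have "square_summable (\<lambda>x. ell2_fun (X M) x + - 1 * (ell2_fun (X M) x - L x))"
      by (intro square_summable_add square_summable_cmult square_summable_ell2_fun)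
    then show ?thesis by simp
  qed
  have "X \<longlonglongrightarrow> Ell2 L"
  proof (rule LIMSEQ_I)
    fix e :: real assume "e > 0"
    then have "e / 2 > 0" by simp
    from CauchyD[OF X this] obtain M
      where M: "\<forall>m\<ge>M. \<forall>n\<ge>M. norm (X m - X n) < e / 2" by blast
    have "norm (X m - Ell2 L) < e" if "m \<ge> M" for m
    proof -
      have eq: "X m - Ell2 L = Ell2 (\<lambda>x. ell2_fun (X m) x - L x)"
        using \<open>square_summable L\<close>
        by (simp add: minus_ell2_def ell2_fun_Ell2)
      have "norm (X m - Ell2 L) \<le> e / 2"
        unfolding eq
        by (rule square_summableI(2)) (use bound[OF _ that M] \<open>e > 0\<close> in auto)
      then show ?thesis using \<open>e > 0\<close> by simp
    qed
    then show "\<exists>M. \<forall>m\<ge>M. norm (X m - Ell2 L) < e" by blast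
  qed
  then show "convergent X" by (rule convergentI)
qed

lemma norm_scaleC_ell2: "norm (scaleC_ell2 c f) = cmod c * norm f"
  by transfer
     (simp add: norm_mult power_mult_distrib real_sqrt_mult infsum_cmult_right')

lift_definition scaleC_op :: "complex \<Rightarrow> 'a ell2 \<Rightarrow>\<^sub>L 'a ell2" is scaleC_ell2
proof (rule bounded_linear_intro)
  fix c r and f g :: "'a ell2"
  show "scaleC_ell2 c (f + g) = scaleC_ell2 c f + scaleC_ell2 c g"
    by transfer (simp add: algebra_simps)
  show "scaleC_ell2 c (r *\<^sub>R f) = r *\<^sub>R scaleC_ell2 c f"
    by transfer (simp add: algebra_simps)
  show "norm (scaleC_ell2 c f) \<le> norm f * cmod c"
    by (simp add: norm_scaleC_ell2)
qed


section \<open>The adjacency operator and its evolution\<close>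

text \<open>
  Bounded operators are represented by the real Banach space of bounded linear maps;
  multiplication by a complex scalar is the operator \<^const>\<open>scaleC_op\<close>.
\<close>

definition adjacency_op :: "('v \<Rightarrow> 'v \<Rightarrow> bool) \<Rightarrow> 'v ell2 \<Rightarrow>\<^sub>L 'v ell2" where
  "adjacency_op E = Blinfun (\<lambda>f. Ell2 (\<lambda>v. \<Sum>w | E v w. ell2_fun f w))"

context regular_tree
begin

lemma adjacency_finite_bound:
  assumes "finite F"
  shows "(\<Sum>v\<in>F. (cmod (\<Sum>w | E v w. ell2_fun f w))\<^sup>2) \<le> (real (q + 1) * norm f)\<^sup>2"
proof -
  define g where "g = ell2_fun f"
  define B where "B = (\<Union>v\<in>F. {w. E v w})"
  have B: "finite B" using assms finite_nbrs by (simp add: B_def)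
  have "(cmod (\<Sum>w | E v w. g w))\<^sup>2 \<le> real (q + 1) * (\<Sum>w | E v w. (cmod (g w))\<^sup>2)" for v
  proof -
    have "(cmod (\<Sum>w | E v w. g w))\<^sup>2 \<le> (\<Sum>w | E v w. cmod (g w))\<^sup>2"
      by (intro power_mono norm_sum) simp
    also have "\<dots> \<le> (\<Sum>w | E v w. (cmod (g w))\<^sup>2) * card {w. E v w}"
      by (rule sum_squared_le_sum_of_squares)
    finally show ?thesis by (simp add: card_nbrs mult.commute)
  qed
  then have "(\<Sum>v\<in>F. (cmod (\<Sum>w | E v w. g w))\<^sup>2)
      \<le> real (q + 1) * (\<Sum>v\<in>F. \<Sum>w | E v w. (cmod (g w))\<^sup>2)"
    unfolding sum_distrib_left by (rule sum_mono)
  also have "(\<Sum>v\<in>F. \<Sum>w | E v w. (cmod (g w))\<^sup>2)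
      = (\<Sum>v\<in>F. \<Sum>w | w \<in> B \<and> E v w. (cmod (g w))\<^sup>2)"
    by (intro sum.cong) (auto simp: B_def)
  also have "\<dots> = (\<Sum>w\<in>B. \<Sum>v | v \<in> F \<and> E v w. (cmod (g w))\<^sup>2)"
    using assms B by (rule sum.swap_restrict)
  also have "\<dots> \<le> (\<Sum>w\<in>B. real (q + 1) * (cmod (g w))\<^sup>2)"
  proof (rule sum_mono)
    fix w
    have "card {v. v \<in> F \<and> E v w} \<le> card {v. E w v}"
      by (rule card_mono) (use finite_nbrs adj_sym in auto)
    then show "(\<Sum>v | v \<in> F \<and> E v w. (cmod (g w))\<^sup>2) \<le> real (q + 1) * (cmod (g w))\<^sup>2"
      unfolding card_nbrs sum_constant by (intro mult_right_mono) simp_all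
  qed
  also have "\<dots> \<le> real (q + 1) * (norm f)\<^sup>2"
    unfolding sum_distrib_left[symmetric] g_def
    by (intro mult_left_mono finite_sum_le_norm_ell2 B) simp
  finally show ?thesis
    by (simp add: g_def power_mult_distrib power2_eq_square ac_simps)
qed

lemma square_summable_adjacency: "square_summable (\<lambda>v. \<Sum>w | E v w. ell2_fun f w)"
  by (rule square_summableI(1)[OF adjacency_finite_bound]) simp_all

lemma bounded_linear_adjacency:
  "bounded_linear (\<lambda>f. Ell2 (\<lambda>v. \<Sum>w | E v w. ell2_fun f w))"
proof (rule bounded_linear_intro)
  fix r and f g :: "'v ell2"
  show "Ell2 (\<lambda>v. \<Sum>w | E v w. ell2_fun (f + g) w) =
        Ell2 (\<lambda>v. \<Sum>w | E v w. ell2_fun f w) + Ell2 (\<lambda>v. \<Sum>w | E v w. ell2_fun g w)"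
    by (rule ell2_fun_inject[THEN iffD1])
       (simp add: plus_ell2.rep_eq ell2_fun_Ell2 square_summable_adjacency
          square_summable_add sum.distrib)
  show "Ell2 (\<lambda>v. \<Sum>w | E v w. ell2_fun (r *\<^sub>R f) w) =
        r *\<^sub>R Ell2 (\<lambda>v. \<Sum>w | E v w. ell2_fun f w)"
    using square_summable_adjacency[of "r *\<^sub>R f"]
    by (intro ell2_fun_inject[THEN iffD1])
       (simp add: scaleR_ell2.rep_eq ell2_fun_Ell2 square_summable_adjacency
          scaleR_sum_right)
  show "norm (Ell2 (\<lambda>v. \<Sum>w | E v w. ell2_fun f w)) \<le> norm f * real (q + 1)"
    by (subst mult.commute, rule square_summableI(2)[OF adjacency_finite_bound]) simp_all
qed

lemma adjacency_op_apply: "ell2_fun (adjacency_op E f) v = (\<Sum>w | E v w. ell2_fun f w)"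
  unfolding adjacency_op_def
  by (simp add: bounded_linear_Blinfun_apply[OF bounded_linear_adjacency]
      ell2_fun_Ell2 square_summable_adjacency)

end

definition exp_blinfun :: "('a::real_normed_vector \<Rightarrow>\<^sub>L 'a) \<Rightarrow> 'a \<Rightarrow>\<^sub>L 'a" where
  "exp_blinfun T = (\<Sum>k. (((o\<^sub>L) T) ^^ k) id_blinfun /\<^sub>R fact k)"

lemma summable_exp_blinfun:
  fixes T :: "'a::banach \<Rightarrow>\<^sub>L 'a"
  shows "summable (\<lambda>k. (((o\<^sub>L) T) ^^ k) id_blinfun /\<^sub>R fact k)"
proof (rule summable_comparison_test')
  show "summable (\<lambda>k. norm T ^ k /\<^sub>R fact k)" by (rule summable_exp_generic)
  have pow: "norm ((((o\<^sub>L) T) ^^ k) id_blinfun) \<le> norm T ^ k" for k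
  proof (induction k)
    case 0
    show ?case by (auto intro: norm_blinfun_bound)
  next
    case (Suc k)
    have "norm ((((o\<^sub>L) T) ^^ Suc k) id_blinfun)
        \<le> norm T * norm ((((o\<^sub>L) T) ^^ k) id_blinfun)"
      by (simp add: norm_blinfun_compose)
    also have "\<dots> \<le> norm T * norm T ^ k" using Suc by (intro mult_left_mono) simp_all
    finally show ?case by simp
  qed
  show "norm ((((o\<^sub>L) T) ^^ k) id_blinfun /\<^sub>R fact k) \<le> norm T ^ k /\<^sub>R fact k"
    if "k \<ge> 0" for k
    using pow[of k] by (simp add: mult_left_mono)
qed

definition evolution :: "('v \<Rightarrow> 'v \<Rightarrow> bool) \<Rightarrow> real \<Rightarrow> 'v ell2 \<Rightarrow>\<^sub>L 'v ell2" where
  "evolution E t = exp_blinfun (scaleC_op (\<i> * t) o\<^sub>L adjacency_op E)"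

definition evolution_kernel :: "('v \<Rightarrow> 'v \<Rightarrow> bool) \<Rightarrow> real \<Rightarrow> 'v \<Rightarrow> 'v \<Rightarrow> complex" where
  "evolution_kernel E t v w = cinner_ell2 (delta_ell2 v) (evolution E t (delta_ell2 w))"


section \<open>The norms of \<open>L\<^sup>1\<close> and \<open>L\<^sup>\<infinity>\<close>\<close>

text \<open>
  A summable \<open>f\<close> is square-summable (\<open>abs_summable_imp_square_summable\<close>), so that
  \<open>Ell2 f\<close> is \<open>f\<close> itself viewed in the Hilbert space.
\<close>

definition norm_one :: "('v \<Rightarrow> complex) \<Rightarrow> real" where
  "norm_one f = (\<Sum>\<^sub>\<infinity>v. cmod (f v))"

definition norm_sup :: "('v \<Rightarrow> complex) \<Rightarrow> real" where
  "norm_sup f = (SUP v. cmod (f v))"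

lemma bdd_above_ell2_fun: "bdd_above (range (\<lambda>v. cmod (ell2_fun f v)))"
  by (rule bdd_aboveI2) (rule cmod_ell2_fun_le_norm)

end

theory Submission
  imports Defs
begin

text \<open>
  Let \<open>s = 2 sqrt q t\<close> and \<open>n = d(v,w)\<close>. Diagonalising the walk counts on the tree by the functions
  \<open>2 sin x (\<Sum>k. q\<^bsup>-k\<^esup> sin ((n + 1 + 2k) x))\<close> on \<open>[0, pi]\<close>, on which a step of the walk acts, up to the
  factor \<open>sqrt q\<close>, as multiplication by \<open>2 cos x\<close>, and integrating by parts once, one gets
  \<open>e\<^bsup>itA\<^esup>(v,w) = (\<Sum>k. q\<^bsup>-n/2-k\<^esup> (2m / s) \<i>\<^bsup>m-1\<^esup> J\<^sub>m(s))\<close> with \<open>m = n + 2k + 1\<close>.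
  The recurrence \<open>J\<^bsub>m-1\<^esub> + J\<^bsub>m+1\<^esub> = (2m / s) J\<^sub>m\<close> and \<open>\<bar>J\<^sub>m\<bar> \<le> 1\<close> reduce \<open>J\<^sub>m\<close> to \<open>J\<^sub>0\<close> or \<open>J\<^sub>1\<close>
  up to \<open>O(m\<^sup>2 / s)\<close>, and the combination \<open>J\<^sub>0 + \<i> J\<^sub>1\<close> is a Fresnel integral up to \<open>O(1 / s)\<close>. The factor \<open>1 / s\<close>
  in the series then leaves an error \<open>O(s\<^sup>-\<^sup>2)\<close>, uniformly in \<open>n\<close> because of the weights \<open>q\<^bsup>-n/2-k\<^esup>\<close>.
\<close>

section \<open>The Fresnel integral\<close>

lemma has_vector_derivative_cis_compose [derivative_intros]:
  assumes "(g has_real_derivative g') (at x within A)"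
  shows "((\<lambda>x. cis (g x)) has_vector_derivative of_real g' * (\<i> * cis (g x))) (at x within A)"
  using has_derivative_cis[OF assms[unfolded has_field_derivative_def]]
  by (simp add: has_vector_derivative_def scaleR_conv_of_real mult_ac)

definition fresnel :: "real \<Rightarrow> complex" where
  "fresnel x = integral {0..x} (\<lambda>u. cis (- (u\<^sup>2)))"

lemma fresnel_has_vector_derivative:
  assumes "x \<in> {0..X}"
  shows "(fresnel has_vector_derivative cis (- (x\<^sup>2))) (at x within {0..X})"
proof -
  have "continuous_on {0..X} (\<lambda>u. cis (- (u\<^sup>2)))"
    by (intro continuous_intros)
  from integral_has_vector_derivative[OF this assms] show ?thesis
    unfolding fresnel_def[abs_def] .
qed

lemma fresnel_scaled_has_vector_derivative:
  assumes "x \<ge> 0" "u \<in> {0..1}"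
  shows "((\<lambda>u. fresnel (x * u)) has_vector_derivative of_real x * cis (- ((x * u)\<^sup>2))) (at u within {0..1})"
proof -
  have 1: "((\<lambda>u. x * u) has_vector_derivative x) (at u within {0..1})"
    by (auto intro!: derivative_eq_intros)
  have sub: "(\<lambda>u. x * u) ` {0..1} \<subseteq> {0..x}"
    using assms by (auto intro: mult_left_le)
  have "(fresnel has_vector_derivative cis (- ((x * u)\<^sup>2))) (at (x * u) within (\<lambda>u. x * u) ` {0..1})"
    by (rule has_vector_derivative_within_subset[OF fresnel_has_vector_derivative sub])
      (use assms in \<open>auto intro: mult_left_le\<close>)
  from vector_diff_chain_within[OF 1 this] show ?thesis
    by (simp add: o_def scaleR_conv_of_real)
qed

lemma fresnel_0 [simp]: "fresnel 0 = 0"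
  by (simp add: fresnel_def)

lemma fresnel_scaled_has_integral:
  assumes "x \<ge> 0"
  shows "((\<lambda>u. of_real x * cis (- ((x * u)\<^sup>2))) has_integral fresnel x) {0..1}"
  using fundamental_theorem_of_calculus[of 0 1 "\<lambda>u. fresnel (x * u)"
      "\<lambda>u. of_real x * cis (- ((x * u)\<^sup>2))"]
    fresnel_scaled_has_vector_derivative[OF assms] by simp

text \<open>As in the classical evaluation of the Gaussian integral, \<open>(fresnel x)\<^sup>2\<close> and
  \<open>- \<i> * fresnel_rest x\<close> have opposite derivatives.\<close>

definition fresnel_rest :: "real \<Rightarrow> complex" where
  "fresnel_rest x = integral {0..1} (\<lambda>u. cis (- (x\<^sup>2 * (1 + u\<^sup>2))) / of_real (1 + u\<^sup>2))"

text \<open>After differentiation under the integral sign, the factor \<open>1 + u^2\<close> from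
  the chain rule cancels the denominator. The phase then splits as \<open>x^2 + (x * u)^2\<close>,
  which leaves the integral of \<open>fresnel_scaled_has_integral\<close>.\<close>

lemma fresnel_rest_has_vector_derivative:
  assumes "x \<in> {0..X}"
  shows "(fresnel_rest has_vector_derivative (- 2 * \<i> * fresnel x * cis (- (x\<^sup>2)))) (at x within {0..X})"
proof -
  have nz: "1 + complex_of_real t * complex_of_real t \<noteq> 0" for t
  proof -
    have "1 + t * t \<noteq> 0"
      by (metis zero_le_square add_pos_nonneg less_irrefl zero_less_one)
    then show ?thesis
      by (metis of_real_1 of_real_add of_real_eq_0_iff of_real_mult)
  qed
  define fx where "fx x t = - 2 * \<i> * of_real x * cis (- (x\<^sup>2 * (1 + t\<^sup>2)))" for x t :: real
  have "((\<lambda>x. integral (cbox 0 1) (\<lambda>u. cis (- (x\<^sup>2 * (1 + u\<^sup>2))) / of_real (1 + u\<^sup>2)))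
     has_vector_derivative integral (cbox 0 1) (fx x)) (at x within {0..X})"
  proof (rule leibniz_rule_vector_derivative)
    fix y t :: real
    have "((\<lambda>x. cis (- (x\<^sup>2 * (1 + t\<^sup>2)))) has_vector_derivative
        of_real (- (2 * y * (1 + t\<^sup>2))) * (\<i> * cis (- (y\<^sup>2 * (1 + t\<^sup>2))))) (at y within {0..X})"
      by (rule has_vector_derivative_cis_compose) (auto intro!: derivative_eq_intros)
    then have "((\<lambda>x. cis (- (x\<^sup>2 * (1 + t\<^sup>2))) / of_real (1 + t\<^sup>2)) has_vector_derivative
        of_real (- (2 * y * (1 + t\<^sup>2))) * (\<i> * cis (- (y\<^sup>2 * (1 + t\<^sup>2)))) / of_real (1 + t\<^sup>2)) (at y within {0..X})"
      by (rule has_vector_derivative_divide)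
    also have "of_real (- (2 * y * (1 + t\<^sup>2))) * (\<i> * cis (- (y\<^sup>2 * (1 + t\<^sup>2)))) / of_real (1 + t\<^sup>2) = fx y t"
      using nz[of t] by (simp add: fx_def field_simps power2_eq_square)
    finally show "((\<lambda>x. cis (- (x\<^sup>2 * (1 + t\<^sup>2))) / of_real (1 + t\<^sup>2)) has_vector_derivative fx y t) (at y within {0..X})" .
  next
    show "(\<lambda>u. cis (- (y\<^sup>2 * (1 + u\<^sup>2))) / of_real (1 + u\<^sup>2)) integrable_on cbox 0 1" for y :: real
      by (rule integrable_continuous) (use nz in \<open>auto intro!: continuous_intros simp: power2_eq_square\<close>)
    show "continuous_on ({0..X} \<times> cbox 0 1) (\<lambda>(x, t). fx x t)"
      unfolding fx_def case_prod_beta by (intro continuous_intros)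
  qed (use assms in auto)
  moreover have "integral (cbox 0 1) (fx x) = - 2 * \<i> * fresnel x * cis (- (x\<^sup>2))"
  proof -
    have "fx x t = (- 2 * \<i> * cis (- (x\<^sup>2))) * (of_real x * cis (- ((x * t)\<^sup>2)))" for t
    proof -
      have "cis (- (x\<^sup>2 * (1 + t\<^sup>2))) = cis (- (x\<^sup>2)) * cis (- ((x * t)\<^sup>2))"
        by (simp add: cis_mult power_mult_distrib algebra_simps)
      then show ?thesis by (simp add: fx_def)
    qed
    then have fx_eq: "fx x = (\<lambda>t. (- 2 * \<i> * cis (- (x\<^sup>2))) * (of_real x * cis (- ((x * t)\<^sup>2))))"
      by (rule ext)
    have "(fx x has_integral (- 2 * \<i> * cis (- (x\<^sup>2))) * fresnel x) {0..1}"
      unfolding fx_eq using assms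
      by (intro has_integral_mult_right fresnel_scaled_has_integral) simp
    then show ?thesis
      by (simp add: integral_unique mult_ac)
  qed
  ultimately show ?thesis by (simp add: fresnel_rest_def[abs_def])
qed

section \<open>Limit of the Fresnel integral and its rate of convergence\<close>

lemma integral_inverse_one_plus_square: "((\<lambda>u. 1 / (1 + u\<^sup>2)) has_integral (pi / 4)) {0..1::real}"
proof -
  have "(arctan has_vector_derivative 1 / (1 + x\<^sup>2)) (at x within {0..1})" for x :: real
    unfolding has_real_derivative_iff_has_vector_derivative[symmetric]
    by (auto intro!: derivative_eq_intros simp: inverse_eq_divide)
  then have "((\<lambda>u. 1 / (1 + u\<^sup>2)) has_integral (arctan 1 - arctan 0)) {0..1::real}"
    by (intro fundamental_theorem_of_calculus) auto
  then show ?thesis by (simp add: arctan_one)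
qed

lemma fresnel_square:
  assumes "x \<ge> 0"
  shows "(fresnel x)\<^sup>2 = - \<i> * (of_real (pi / 4) - fresnel_rest x)"
proof -
  have "((\<lambda>x. (fresnel x)\<^sup>2 - \<i> * fresnel_rest x) has_vector_derivative 0) (at y within {0..x})"
    if "y \<in> {0..x}" for y
    unfolding power2_eq_square
    by (rule derivative_eq_intros fresnel_has_vector_derivative fresnel_rest_has_vector_derivative that refl)+
       (simp add: algebra_simps)
  then have "((\<lambda>x. 0) has_integral ((fresnel x)\<^sup>2 - \<i> * fresnel_rest x) - ((fresnel 0)\<^sup>2 - \<i> * fresnel_rest 0)) {0..x}"
    using assms by (intro fundamental_theorem_of_calculus)
  then have "(fresnel x)\<^sup>2 - \<i> * fresnel_rest x = - \<i> * fresnel_rest 0"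
    by (auto dest!: has_integral_unique[OF has_integral_0] simp: eq_neg_iff_add_eq_0)
  \<comment> \<open>At 0 the integrand is \<open>1 / (1 + u^2)\<close> and \<open>fresnel\<close>
    vanishes, so this value fixes the constant of integration.\<close>
  moreover have "fresnel_rest 0 = of_real (pi / 4)"
    unfolding fresnel_rest_def
    using has_integral_linear[OF integral_inverse_one_plus_square bounded_linear_of_real[where 'a=complex]]
    by (intro integral_unique) (simp add: o_def)
  ultimately show ?thesis by (simp add: algebra_simps)
qed

lemma norm_fresnel_rest_le: "cmod (fresnel_rest x) \<le> pi / 4"
proof -
  have nz: "1 + (complex_of_real u)\<^sup>2 \<noteq> 0" for u
    by (metis of_real_1 of_real_add of_real_eq_0_iff of_real_power add_pos_nonneg zero_less_one zero_le_power2 less_irrefl)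
  have "cmod (fresnel_rest x) \<le> integral {0..1} (\<lambda>u. 1 / (1 + u\<^sup>2))"
    unfolding fresnel_rest_def
  proof (rule integral_norm_bound_integral)
    show "(\<lambda>u. cis (- (x\<^sup>2 * (1 + u\<^sup>2))) / of_real (1 + u\<^sup>2)) integrable_on {0..1}"
      using nz by (intro integrable_continuous_real continuous_intros) auto
    show "(\<lambda>u. 1 / (1 + u\<^sup>2)) integrable_on {0..1::real}"
      using integral_inverse_one_plus_square by blast
  next
    fix u :: real
    have "cmod (of_real (1 + u\<^sup>2)) = 1 + u\<^sup>2" unfolding norm_of_real by simp
    then show "cmod (cis (- (x\<^sup>2 * (1 + u\<^sup>2))) / of_real (1 + u\<^sup>2)) \<le> 1 / (1 + u\<^sup>2)"
      by (simp only: norm_divide norm_cis)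
  qed
  then show ?thesis using integral_unique[OF integral_inverse_one_plus_square] by simp
qed

text \<open>By \<open>fresnel_square\<close> and \<open>norm_fresnel_rest_le\<close> the square has
  modulus at most \<open>pi / 2\<close>. This a priori bound controls the terms of the integration
  by parts in \<open>norm_fresnel_rest_decay\<close>.\<close>

lemma norm_fresnel_le:
  assumes "x \<ge> 0"
  shows "cmod (fresnel x) \<le> 2"
proof (rule power2_le_imp_le)
  have "(cmod (fresnel x))\<^sup>2 = cmod ((fresnel x)\<^sup>2)" by (simp add: norm_power)
  also have "\<dots> \<le> cmod (of_real (pi / 4)) + cmod (fresnel_rest x)"
    unfolding fresnel_square[OF assms] norm_mult
    using norm_triangle_ineq4[of "of_real (pi / 4)" "fresnel_rest x"] by simp
  also have "\<dots> \<le> 2\<^sup>2"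
    using norm_fresnel_rest_le[of x] pi_less_4 by (simp add: norm_divide)
  finally show "(cmod (fresnel x))\<^sup>2 \<le> 2\<^sup>2" .
qed simp

text \<open>Integrate by parts in \<open>u\<close>, with \<open>fresnel (x * u) / x\<close> as
  antiderivative of \<open>cis (- ((x * u)^2))\<close>. Since \<open>fresnel\<close> is bounded by
  2, the boundary term contributes \<open>1 / x\<close> and the remaining integrand \<open>k\<close>
  at most \<open>4 / x\<close>.\<close>

lemma norm_fresnel_rest_decay:
  assumes "x > 0"
  shows "cmod (fresnel_rest x) \<le> 5 / x"
proof -
  have pos: "1 + u\<^sup>2 > 0" for u :: real by (simp add: add_pos_nonneg)
  define k where "k u = of_real (- (2 * u / (1 + u\<^sup>2)\<^sup>2)) * (fresnel (x * u) / of_real x)" for u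
  have contF: "continuous_on {0..1} (\<lambda>u. fresnel (x * u))"
    using fresnel_scaled_has_vector_derivative[of x] assms
    by (intro continuous_on_vector_derivative) auto
  have contk: "continuous_on {0..1} k"
    unfolding k_def using assms pos
    by (intro continuous_intros contF) (auto simp: less_imp_neq[THEN not_sym])
  have "((\<lambda>u. of_real (1 / (1 + u\<^sup>2)) * (of_real x * cis (- ((x * u)\<^sup>2)) / of_real x) + k u)
      has_integral of_real (1 / (1 + 1\<^sup>2)) * (fresnel (x * 1) / of_real x) -
        of_real (1 / (1 + 0\<^sup>2)) * (fresnel (x * 0) / of_real x)) {0..1}"
  proof (rule fundamental_theorem_of_calculus)
    fix u :: real assume u: "u \<in> {0..1}"
    have "((\<lambda>u. 1 / (1 + u\<^sup>2)) has_real_derivative - (2 * u / (1 + u\<^sup>2)\<^sup>2)) (at u within {0..1})"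
      using pos[of u] by (auto intro!: derivative_eq_intros simp: power2_eq_square)
    then have "((\<lambda>u. complex_of_real (1 / (1 + u\<^sup>2))) has_vector_derivative
         of_real (- (2 * u / (1 + u\<^sup>2)\<^sup>2))) (at u within {0..1})"
      by (rule has_vector_derivative_of_real)
    then show "((\<lambda>u. complex_of_real (1 / (1 + u\<^sup>2)) * (fresnel (x * u) / of_real x)) has_vector_derivative
      of_real (1 / (1 + u\<^sup>2)) * (of_real x * cis (- ((x * u)\<^sup>2)) / of_real x) + k u) (at u within {0..1})"
      unfolding k_def using u assms
      by (intro has_vector_derivative_mult has_vector_derivative_divide fresnel_scaled_has_vector_derivative) auto
  qed simp
  then have "((\<lambda>u. of_real (1 / (1 + u\<^sup>2)) * (of_real x * cis (- ((x * u)\<^sup>2)) / of_real x) + k u - k u)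
      has_integral fresnel x / (2 * of_real x) - integral {0..1} k) {0..1}"
    by (intro has_integral_diff integrable_integral integrable_continuous_real contk) simp
  then have "((\<lambda>u. cis (- (x\<^sup>2)) * (of_real (1 / (1 + u\<^sup>2)) * (of_real x * cis (- ((x * u)\<^sup>2)) / of_real x)))
      has_integral cis (- (x\<^sup>2)) * (fresnel x / (2 * of_real x) - integral {0..1} k)) {0..1}"
    by (intro has_integral_mult_right) simp
  moreover have "cis (- (x\<^sup>2)) * (of_real (1 / (1 + u\<^sup>2)) * (of_real x * cis (- ((x * u)\<^sup>2)) / of_real x))
     = cis (- (x\<^sup>2 * (1 + u\<^sup>2))) / of_real (1 + u\<^sup>2)" for u
  proof -
    have "cis (- (x\<^sup>2 * (1 + u\<^sup>2))) = cis (- (x\<^sup>2)) * cis (- ((x * u)\<^sup>2))"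
      by (simp add: cis_mult power_mult_distrib algebra_simps)
    then show ?thesis using assms by simp
  qed
  ultimately have "fresnel_rest x = cis (- (x\<^sup>2)) * (fresnel x / (2 * of_real x) - integral {0..1} k)"
    unfolding fresnel_rest_def by (intro integral_unique) (simp only:)
  then have "cmod (fresnel_rest x) = cmod (fresnel x / (2 * of_real x) - integral {0..1} k)"
    by (simp add: norm_mult)
  also have "\<dots> \<le> cmod (fresnel x / (2 * of_real x)) + cmod (integral {0..1} k)"
    by (rule norm_triangle_ineq4)
  also have "cmod (fresnel x / (2 * of_real x)) \<le> 1 / x"
    using norm_fresnel_le[of x] assms by (simp add: norm_divide norm_mult field_simps)
  also have "cmod (integral {0..1} k) \<le> integral {0..1} (\<lambda>u::real. 4 / x)"
  proof (rule integral_norm_bound_integral)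
    fix u :: real assume u: "u \<in> {0..1}"
    have "(1 + u\<^sup>2)\<^sup>2 \<ge> 1" by simp
    then have "2 * u / (1 + u\<^sup>2)\<^sup>2 \<le> 2 / 1" using u by (intro frac_le) auto
    moreover have "0 \<le> 2 * u / (1 + u\<^sup>2)\<^sup>2" using u by simp
    moreover have "cmod (fresnel (x * u) / of_real x) \<le> 2 / x"
      using norm_fresnel_le[of "x * u"] assms u by (simp add: norm_divide divide_right_mono)
    ultimately have "cmod (k u) \<le> 2 * (2 / x)"
      unfolding k_def norm_mult norm_of_real abs_minus using assms by (intro mult_mono) auto
    then show "cmod (k u) \<le> 4 / x" by simp
  qed (auto intro: integrable_continuous_real contk)
  finally show ?thesis by simp
qed

text \<open>This sign selects the right square root in \<open>fresnel_square\<close>.\<close>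

lemma Im_fresnel_nonpos:
  assumes "x > 0"
  shows "Im (fresnel x) \<le> 0"
proof (rule field_le_epsilon)
  fix e :: real assume e: "e > 0"
  \<comment> \<open>Cutting at \<open>d\<close> avoids division by 0 in the derivative of
    \<open>F\<close>. On \<open>[0, d]\<close> one has \<open>y^2 <= 1 < pi\<close>, so
    \<open>sin (y^2)\<close> is nonnegative there, and \<open>d <= e\<close> bounds the boundary
    term at \<open>d\<close> by \<open>e\<close>.\<close>
  define d where "d = min x (min 1 e)"
  have d: "d > 0" "d \<le> x" "d \<le> 1" "d \<le> e" using assms e by (auto simp: d_def)
  \<comment> \<open>Integration by parts of \<open>sin (y^2)\<close>, read as the derivative of
    \<open>1 - cos (y^2)\<close> divided by \<open>2 * y\<close>: \<open>F\<close> subtracts the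
    boundary term, and its derivative is a nonnegative function.\<close>
  define F where "F y = - Im (fresnel y) - (1 - cos (y\<^sup>2)) / (2 * y)" for y
  have ImD: "((\<lambda>y. Im (fresnel y)) has_real_derivative - sin (y\<^sup>2)) (at y within {0..x})"
    if "y \<in> {0..x}" for y
    using bounded_linear.has_vector_derivative[OF bounded_linear_Im fresnel_has_vector_derivative[OF that]]
    by (simp add: has_real_derivative_iff_has_vector_derivative)
  have "((\<lambda>y. (1 - cos (y\<^sup>2)) / (2 * y\<^sup>2)) has_integral F x - F d) {d..x}"
  proof (rule fundamental_theorem_of_calculus)
    fix y assume y: "y \<in> {d..x}"
    have D1: "((\<lambda>y. Im (fresnel y)) has_real_derivative - sin (y\<^sup>2)) (at y within {d..x})"
      by (rule DERIV_subset[OF ImD]) (use y d in auto)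
    have D2: "((\<lambda>y. (1 - cos (y\<^sup>2)) / (2 * y)) has_real_derivative
        sin (y\<^sup>2) - (1 - cos (y\<^sup>2)) / (2 * y\<^sup>2)) (at y within {d..x})"
      using y d by (auto intro!: derivative_eq_intros simp: field_simps power2_eq_square)
    from DERIV_diff[OF DERIV_minus[OF D1] D2]
    have "(F has_real_derivative (1 - cos (y\<^sup>2)) / (2 * y\<^sup>2)) (at y within {d..x})"
      by (simp add: F_def[abs_def])
    then show "(F has_vector_derivative (1 - cos (y\<^sup>2)) / (2 * y\<^sup>2)) (at y within {d..x})"
      by (simp add: has_real_derivative_iff_has_vector_derivative)
  qed (use d in simp)
  then have "F x - F d \<ge> 0"
    by (rule has_integral_nonneg) simp
  moreover have "((\<lambda>y. sin (y\<^sup>2)) has_integral (- Im (fresnel d) - (- Im (fresnel 0)))) {0..d}"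
  proof (rule fundamental_theorem_of_calculus)
    fix y assume y: "y \<in> {0..d}"
    have "((\<lambda>y. Im (fresnel y)) has_real_derivative - sin (y\<^sup>2)) (at y within {0..d})"
      by (rule DERIV_subset[OF ImD]) (use y d in auto)
    from DERIV_minus[OF this] have "((\<lambda>y. - Im (fresnel y)) has_real_derivative sin (y\<^sup>2)) (at y within {0..d})"
      by simp
    then show "((\<lambda>y. - Im (fresnel y)) has_vector_derivative sin (y\<^sup>2)) (at y within {0..d})"
      by (simp add: has_real_derivative_iff_has_vector_derivative)
  qed (use d in simp)
  then have "- Im (fresnel d) - (- Im (fresnel 0)) \<ge> 0"
  proof (rule has_integral_nonneg)
    fix y assume "y \<in> {0..d}"
    then have "y\<^sup>2 \<le> 1" using d by (auto simp: abs_square_le_1)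
    then show "0 \<le> sin (y\<^sup>2)" using pi_gt3 by (intro sin_ge_zero) auto
  qed
  moreover have "(1 - cos (d\<^sup>2)) / (2 * d) \<le> e"
  proof -
    have "1 - cos (d\<^sup>2) = 2 * (sin (d\<^sup>2 / 2))\<^sup>2"
      using cos_double_sin[of "d\<^sup>2 / 2"] by simp
    also have "\<dots> \<le> 2 * \<bar>sin (d\<^sup>2 / 2)\<bar>"
      using power_decreasing[of 1 2 "\<bar>sin (d\<^sup>2 / 2)\<bar>"] by simp
    also have "\<dots> \<le> d\<^sup>2" using abs_sin_x_le_abs_x[of "d\<^sup>2 / 2"] by simp
    finally have "(1 - cos (d\<^sup>2)) / (2 * d) \<le> d\<^sup>2 / (2 * d)"
      using d by (intro divide_right_mono) auto
    also have "\<dots> \<le> e" using d by (simp add: power2_eq_square)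
    finally show ?thesis .
  qed
  moreover have "(1 - cos (x\<^sup>2)) / (2 * x) \<ge> 0" using assms by simp
  ultimately show "Im (fresnel x) \<le> 0 + e" by (simp add: F_def)
qed

text \<open>The squares of \<open>fresnel x\<close> and of the limit \<open>L\<close> differ by
  \<open>\<i> * fresnel_rest x\<close>, which is \<open>O(1 / x)\<close>. The imaginary parts of
  both have the same sign, so the factor \<open>fresnel x + L\<close> has modulus at least 1/2 and
  can be divided out.\<close>

lemma fresnel_asymptotic:
  assumes "x > 0"
  shows "cmod (fresnel x - of_real (sqrt pi / 2) * cis (- pi / 4)) \<le> 10 / x"
proof -
  define L where "L = of_real (sqrt pi / 2) * cis (- pi / 4)"
  have "L\<^sup>2 = of_real ((sqrt pi / 2)\<^sup>2) * cis (- pi / 2)"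
    unfolding L_def power_mult_distrib Complex.DeMoivre of_real_power by simp
  also have "\<dots> = - \<i> * of_real (pi / 4)"
    by (simp add: cis_minus_pi_half power_divide)
  finally have "(fresnel x - L) * (fresnel x + L) = \<i> * fresnel_rest x"
    using fresnel_square[of x] assms by (simp add: algebra_simps power2_eq_square)
  then have prod: "cmod (fresnel x - L) * cmod (fresnel x + L) \<le> 5 / x"
    using norm_fresnel_rest_decay[OF assms] by (simp flip: norm_mult) (simp add: norm_mult)
  have "Im L = - (sqrt pi * sqrt 2 / 4)"
    by (simp add: L_def sin_45)
  moreover have "sqrt pi * sqrt 2 \<ge> 2"
    unfolding real_sqrt_mult[symmetric] using pi_gt3 by (intro real_le_rsqrt) simp
  ultimately have "1 / 2 \<le> \<bar>Im (fresnel x + L)\<bar>"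
    using Im_fresnel_nonpos[OF assms] by simp
  also have "\<dots> \<le> cmod (fresnel x + L)" by (rule abs_Im_le_cmod)
  finally have "cmod (fresnel x - L) * (1 / 2) \<le> cmod (fresnel x - L) * cmod (fresnel x + L)"
    by (intro mult_left_mono) auto
  then show ?thesis using prod unfolding L_def by simp
qed

section \<open>Bessel functions\<close>

text \<open>This is \<open>\<i>\<^sup>m J\<^sub>m(s)\<close> for the Bessel function \<open>J\<^sub>m\<close>.\<close>

definition bessel_int :: "nat \<Rightarrow> real \<Rightarrow> complex" where
  "bessel_int m s = integral {0..pi} (\<lambda>x. cis (s * cos x) * of_real (cos (m * x))) / of_real pi"

text \<open>With the factor \<open>sin x\<close>, the oscillating part is an exact derivative up to
  \<open>- \<i> * s\<close>. The weight vanishes at the stationary points 0 and pi of the phase, so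
  a full factor \<open>1 / s\<close> is gained.\<close>

lemma integral_by_parts_cis_cos:
  fixes f f' :: "real \<Rightarrow> real"
  assumes deriv: "\<And>x. x \<in> {0..pi} \<Longrightarrow> (f has_real_derivative f' x) (at x within {0..pi})"
    and cont: "continuous_on {0..pi} f'"
  shows "\<i> * of_real s * integral {0..pi} (\<lambda>x. cis (s * cos x) * of_real (sin x * f x)) =
    cis s * of_real (f 0) - cis (- s) * of_real (f pi) +
    integral {0..pi} (\<lambda>x. cis (s * cos x) * of_real (f' x))"
proof -
  have contf: "continuous_on {0..pi} f"
    using deriv by (intro DERIV_continuous_on) auto
  have "((\<lambda>x. cis (s * cos x) * of_real (f' x) +
      of_real (- (s * sin x)) * (\<i> * cis (s * cos x)) * of_real (f x))
      has_integral cis (s * cos pi) * of_real (f pi) - cis (s * cos 0) * of_real (f 0)) {0..pi}"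
  proof (rule fundamental_theorem_of_calculus)
    fix x :: real assume x: "x \<in> {0..pi}"
    show "((\<lambda>x. cis (s * cos x) * complex_of_real (f x)) has_vector_derivative
        cis (s * cos x) * of_real (f' x) + of_real (- (s * sin x)) * (\<i> * cis (s * cos x)) * of_real (f x))
        (at x within {0..pi})"
      by (intro has_vector_derivative_mult has_vector_derivative_cis_compose
          has_vector_derivative_of_real deriv x) (auto intro!: derivative_eq_intros)
  qed simp
  moreover have "((\<lambda>x. cis (s * cos x) * of_real (f' x) -
      \<i> * of_real s * (cis (s * cos x) * of_real (sin x * f x))) has_integral
      integral {0..pi} (\<lambda>x. cis (s * cos x) * of_real (f' x)) -
      \<i> * of_real s * integral {0..pi} (\<lambda>x. cis (s * cos x) * of_real (sin x * f x))) {0..pi}"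
    by (intro has_integral_diff has_integral_mult_right integrable_integral
        integrable_continuous_real continuous_intros contf cont)
  moreover have "cis (s * cos x) * of_real (f' x) + of_real (- (s * sin x)) * (\<i> * cis (s * cos x)) * of_real (f x) =
      cis (s * cos x) * of_real (f' x) - \<i> * of_real s * (cis (s * cos x) * of_real (sin x * f x))" for x
    by simp
  ultimately have "cis (s * cos pi) * of_real (f pi) - cis (s * cos 0) * of_real (f 0) =
      integral {0..pi} (\<lambda>x. cis (s * cos x) * of_real (f' x)) -
      \<i> * of_real s * integral {0..pi} (\<lambda>x. cis (s * cos x) * of_real (sin x * f x))"
    by (simp only: has_integral_unique)
  then show ?thesis by (simp add: algebra_simps)
qed

lemma norm_bessel_int_le: "cmod (bessel_int m s) \<le> 1"
proof -
  have "cmod (integral {0..pi} (\<lambda>x. cis (s * cos x) * of_real (cos (m * x)))) \<le>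
      integral {0..pi} (\<lambda>x::real. 1)"
    by (intro integral_norm_bound_integral integrable_continuous_real continuous_intros)
       (simp add: norm_mult)
  then show ?thesis by (simp add: bessel_int_def norm_divide)
qed

text \<open>The boundary terms vanish because \<open>m\<close> is an integer. The formula serves
  twice: for the recurrence of the Bessel functions and for each term of the series for the
  kernel.\<close>

lemma integral_sin_sin_cis_cos:
  assumes "s \<noteq> 0"
  shows "integral {0..pi} (\<lambda>x. cis (s * cos x) * of_real (2 * sin x * sin (m * x))) / of_real pi =
    2 * of_nat m / (\<i> * of_real s) * bessel_int m s"
proof -
  have "\<i> * of_real s * integral {0..pi} (\<lambda>x. cis (s * cos x) * of_real (sin x * (2 * sin (m * x)))) =
    cis s * of_real (2 * sin (real m * 0)) - cis (- s) * of_real (2 * sin (real m * pi)) +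
    integral {0..pi} (\<lambda>x. cis (s * cos x) * of_real (2 * (m * cos (m * x))))"
    by (rule integral_by_parts_cis_cos) (auto intro!: derivative_eq_intros continuous_intros)
  also have "integral {0..pi} (\<lambda>x. cis (s * cos x) * of_real (2 * (m * cos (m * x)))) =
      integral {0..pi} (\<lambda>x. (2 * of_nat m) * (cis (s * cos x) * of_real (cos (m * x))))"
    by (rule integral_cong) simp
  also have "\<dots> = (2 * of_nat m) * (of_real pi * bessel_int m s)"
    by (simp add: bessel_int_def)
  finally show ?thesis using assms
    by (simp add: field_simps sin_npi)
qed

text \<open>This is the classical three-term recurrence; the minus sign comes from the factor
  \<open>\<i> ^ m\<close> in \<open>bessel_int\<close>. It follows from the product formula for
  \<open>2 sin x sin ((m + 1) x)\<close>.\<close>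

lemma bessel_int_rec:
  assumes "s \<noteq> 0"
  shows "bessel_int m s - bessel_int (m + 2) s =
    2 * of_nat (m + 1) / (\<i> * of_real s) * bessel_int (m + 1) s"
proof -
  have "cos (real m * x) - cos (real (m + 2) * x) = 2 * sin x * sin (real (m + 1) * x)" for x
    using cos_add[of "real (m + 1) * x" x] cos_diff[of "real (m + 1) * x" x]
    by (simp add: algebra_simps)
  then have eq: "cis (s * cos x) * of_real (2 * sin x * sin (real (m + 1) * x)) =
      cis (s * cos x) * of_real (cos (real m * x)) - cis (s * cos x) * of_real (cos (real (m + 2) * x))" for x
    by (metis of_real_diff right_diff_distrib)
  show ?thesis
    unfolding integral_sin_sin_cis_cos[OF assms, symmetric] eq
    unfolding bessel_int_def diff_divide_distrib[symmetric]
    by (subst integral_diff) (auto intro!: integrable_continuous_real continuous_intros)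
qed

text \<open>The reflection of \<open>x\<close> to \<open>pi - x\<close> conjugates
  \<open>cis (s * cos x)\<close> and multiplies \<open>cos (m * x)\<close> by
  \<open>(- 1) ^ m\<close>. It amounts to \<open>J_m\<close> being real, so that the orders 0 and 1
  can be recovered from their sum.\<close>

lemma cnj_bessel_int: "cnj (bessel_int m s) = (- 1) ^ m * bessel_int m s"
proof -
  define f where "f x = cis (s * cos x) * of_real (cos (m * x))" for x :: real
  have "(f has_integral integral {0..pi} f) (cbox 0 pi)"
    unfolding f_def cbox_interval
    by (intro integrable_integral integrable_continuous_real continuous_intros)
  from has_integral_affinity[OF this, of "-1" pi]
  have 1: "((\<lambda>x. f (pi - x)) has_integral integral {0..pi} f) {0..pi}"
    by (simp add: image_affinity_cbox algebra_simps)
  have cosm: "cos (m * (pi - x)) = (- 1) ^ m * cos (m * x)" for x :: real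
    by (simp add: right_diff_distrib cos_diff sin_npi cos_npi mult.commute[of m pi])
  have "f (pi - x) = (- 1) ^ m * cnj (f x)" for x
    unfolding f_def cosm by (simp add: cis_cnj)
  then have "((\<lambda>x. (- 1) ^ m * cnj (f x)) has_integral integral {0..pi} f) {0..pi}"
    using 1 by simp
  moreover have "((\<lambda>x. (- 1) ^ m * cnj (f x)) has_integral (- 1) ^ m * cnj (integral {0..pi} f)) {0..pi}"
    using has_integral_linear[OF \<open>(f has_integral integral {0..pi} f) (cbox 0 pi)\<close> bounded_linear_cnj]
    by (intro has_integral_mult_right) (simp add: o_def)
  ultimately have "integral {0..pi} f = (- 1) ^ m * cnj (integral {0..pi} f)"
    by (rule has_integral_unique)
  then have "(- 1) ^ m * integral {0..pi} f = cnj (integral {0..pi} f)"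
    by (metis mult.assoc mult_1 power_add[symmetric] power_mult_distrib mult_minus1 minus_minus power_one
        left_minus_one_mult_self)
  then show ?thesis by (simp add: bessel_int_def f_def[abs_def])
qed

text \<open>The leading term of \<open>J_0 + \<i> J_1\<close>. Combined with its conjugate according
  to the parity of \<open>m\<close>, it is the leading term of \<open>bessel_int m\<close>.\<close>

definition bessel_wave :: "real \<Rightarrow> complex" where
  "bessel_wave s = of_real (sqrt (2 / (pi * s))) * cis (s - pi / 4)"

text \<open>Since \<open>1 + cos x\<close> is \<open>2 cos(x/2)\<close> times
  \<open>cos(x/2)\<close>, its difference from \<open>2 cos(x/2)\<close> is
  \<open>2 cos(x/2) (1 - cos(x/2))\<close>, and
  \<open>1 - cos(x/2) = sin(x/2) tan(x/4)\<close>.\<close>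

lemma one_plus_cos_eq:
  assumes "cos (x / 4) \<noteq> (0 :: real)"
  shows "1 + cos x = 2 * cos (x / 2) - sin x * tan (x / 4)"
proof -
  define y where "y = x / 4"
  have x: "x = 2 * (2 * y)" "x / 2 = 2 * y" "x / 4 = y" by (simp_all add: y_def)
  have "sin (2 * y) * tan y = 1 - cos (2 * y)"
    using assms unfolding x sin_double cos_double_sin tan_def by (simp add: power2_eq_square)
  then have "sin x * tan y = 2 * cos (2 * y) * (1 - cos (2 * y))"
    unfolding x(1) sin_double[of "2 * y"] by (simp add: mult_ac)
  moreover have "1 + cos x = 2 * cos (2 * y) * cos (2 * y)"
    unfolding x(1) cos_double_cos[of "2 * y"] by (simp add: power2_eq_square)
  ultimately show ?thesis unfolding x(2,3) by (simp add: algebra_simps)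
qed

text \<open>Substitute \<open>v = sqrt(2 s) sin(x/2)\<close>: then \<open>s cos x = s - v^2\<close>,
  and \<open>cos(x/2)\<close> is the Jacobian up to a constant.\<close>

lemma integral_cis_cos_half:
  assumes "s > 0"
  shows "((\<lambda>x. cis (s * cos x) * of_real (2 * cos (x / 2))) has_integral
    cis s * (4 / of_real (sqrt (2 * s))) * fresnel (sqrt (2 * s))) {0..pi}"
proof -
  define r where "r = sqrt (2 * s)"
  have r: "r > 0" "r\<^sup>2 = 2 * s" using assms by (auto simp: r_def)
  define c where "c = cis s * (4 / of_real r)"
  have "((\<lambda>x. c * ((r * cos (x / 2) / 2) *\<^sub>R cis (- ((r * sin (x / 2))\<^sup>2)))) has_integral
      c * fresnel (r * sin (pi / 2)) - c * fresnel (r * sin (0 / 2))) {0..pi}"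
  proof (rule fundamental_theorem_of_calculus)
    fix x :: real assume x: "x \<in> {0..pi}"
    have sub: "(\<lambda>x. r * sin (x / 2)) ` {0..pi} \<subseteq> {0..r}"
      using r by (auto intro!: mult_nonneg_nonneg sin_ge_zero mult_left_le[of "sin _"])
    have 1: "((\<lambda>x. r * sin (x / 2)) has_vector_derivative r * cos (x / 2) / 2) (at x within {0..pi})"
      unfolding has_real_derivative_iff_has_vector_derivative[symmetric]
      by (auto intro!: derivative_eq_intros)
    have "(fresnel has_vector_derivative cis (- ((r * sin (x / 2))\<^sup>2)))
        (at (r * sin (x / 2)) within (\<lambda>x. r * sin (x / 2)) ` {0..pi})"
      by (rule has_vector_derivative_within_subset[OF fresnel_has_vector_derivative sub]) (use sub x in blast)
    from vector_diff_chain_within[OF 1 this]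
    show "((\<lambda>x. c * fresnel (r * sin (x / 2))) has_vector_derivative
        c * ((r * cos (x / 2) / 2) *\<^sub>R cis (- ((r * sin (x / 2))\<^sup>2)))) (at x within {0..pi})"
      by (intro has_vector_derivative_mult_right) (simp add: o_def)
  qed simp
  moreover have "c * ((r * cos (x / 2) / 2) *\<^sub>R cis (- ((r * sin (x / 2))\<^sup>2))) =
      cis (s * cos x) * of_real (2 * cos (x / 2))" for x
  proof -
    have cosx: "cos x = 1 - 2 * (sin (x / 2))\<^sup>2"
      using cos_double_sin[of "x / 2"] by simp
    have "s * cos x = s + - ((r * sin (x / 2))\<^sup>2)"
      unfolding cosx by (simp add: power_mult_distrib r algebra_simps)
    then have "cis (s * cos x) = cis s * cis (- ((r * sin (x / 2))\<^sup>2))"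
      by (simp only: cis_mult)
    then show ?thesis using r by (simp add: c_def scaleR_conv_of_real)
  qed
  ultimately show ?thesis by (simp add: c_def r_def)
qed

text \<open>On \<open>[0, pi]\<close> the function \<open>tan (x / 4)\<close> is smooth and
  increases from 0 to 1. After integration by parts, the boundary value and the total variation each
  contribute 1.\<close>

lemma norm_integral_cis_cos_tan:
  assumes "s > 0"
  shows "cmod (integral {0..pi} (\<lambda>x. cis (s * cos x) * of_real (sin x * tan (x / 4)))) \<le> 2 / s"
proof -
  have pos: "cos (x / 4) > 0" if "x \<in> {0..pi}" for x
    using that pi_gt_zero unfolding atLeastAtMost_iff by (intro cos_gt_zero_pi) linarith+
  define f' where "f' x = 1 / (4 * (cos (x / 4))\<^sup>2)" for x :: real
  have deriv: "((\<lambda>x. tan (x / 4)) has_real_derivative f' x) (at x within {0..pi})" if "x \<in> {0..pi}" for x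
    unfolding f'_def using pos[OF that] by (auto intro!: derivative_eq_intros simp: inverse_eq_divide)
  have cont: "continuous_on {0..pi} f'"
    unfolding f'_def by (intro continuous_intros) (auto dest!: pos)
  have "\<i> * of_real s * integral {0..pi} (\<lambda>x. cis (s * cos x) * of_real (sin x * tan (x / 4))) =
    cis s * of_real (tan (0 / 4)) - cis (- s) * of_real (tan (pi / 4)) +
    integral {0..pi} (\<lambda>x. cis (s * cos x) * of_real (f' x))"
    by (rule integral_by_parts_cis_cos[OF deriv cont])
  then have "cmod (\<i> * of_real s * integral {0..pi} (\<lambda>x. cis (s * cos x) * of_real (sin x * tan (x / 4))))
     = cmod (integral {0..pi} (\<lambda>x. cis (s * cos x) * of_real (f' x)) - cis (- s))"
    by (simp add: tan_45)
  also have "\<dots> \<le> cmod (integral {0..pi} (\<lambda>x. cis (s * cos x) * of_real (f' x))) + 1"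
    using norm_triangle_ineq4[of _ "cis (- s)"] by simp
  also have "cmod (integral {0..pi} (\<lambda>x. cis (s * cos x) * of_real (f' x))) \<le> integral {0..pi} f'"
  proof (rule integral_norm_bound_integral)
    fix x show "cmod (cis (s * cos x) * of_real (f' x)) \<le> f' x"
      unfolding norm_mult norm_cis norm_of_real by (simp add: f'_def)
  qed (auto intro!: integrable_continuous_real continuous_intros cont)
  also have "integral {0..pi} f' = 1"
  proof (rule integral_unique)
    have "(f' has_integral tan (pi / 4) - tan (0 / 4)) {0..pi}"
      by (rule fundamental_theorem_of_calculus)
         (use deriv in \<open>auto simp: has_real_derivative_iff_has_vector_derivative\<close>)
    then show "(f' has_integral 1) {0..pi}" by (simp add: tan_45)
  qed
  finally show ?thesis using assms by (simp add: norm_mult field_simps)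
qed

text \<open>The weight \<open>1 + cos x\<close> removes the stationary point \<open>x = pi\<close>. In the decomposition
  \<open>one_plus_cos_eq\<close> the first summand becomes a Fresnel integral under \<open>u = sin (x / 2)\<close>, and the
  second contains the factor \<open>sin x\<close>, so that one integration by parts gains \<open>1 / s\<close>.\<close>

lemma bessel_int_0_1_asymptotic:
  assumes "s > 0"
  shows "cmod (bessel_int 0 s + bessel_int 1 s - bessel_wave s) \<le> 8 / s"
proof -
  let ?R = "integral {0..pi} (\<lambda>x. cis (s * cos x) * of_real (sin x * tan (x / 4)))"
  let ?L = "of_real (sqrt pi / 2) * cis (- pi / 4)"
  let ?c = "cis s * (4 / of_real (sqrt (2 * s)))"
  have pos: "cos (x / 4) > 0" if "x \<in> {0..pi}" for x
    using that pi_gt_zero unfolding atLeastAtMost_iff by (intro cos_gt_zero_pi) linarith+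
  have "of_real pi * (bessel_int 0 s + bessel_int 1 s) =
      integral {0..pi} (\<lambda>x. cis (s * cos x) * of_real (1 + cos x))"
    unfolding bessel_int_def add_divide_distrib[symmetric]
    by (subst integral_add[symmetric]) (auto intro!: integrable_continuous_real continuous_intros simp: algebra_simps)
  also have "\<dots> = integral {0..pi} (\<lambda>x. cis (s * cos x) * of_real (2 * cos (x / 2)) -
      cis (s * cos x) * of_real (sin x * tan (x / 4)))"
  proof (rule integral_cong)
    fix x assume "x \<in> {0..pi}"
    from one_plus_cos_eq[of x] pos[OF this]
    show "cis (s * cos x) * of_real (1 + cos x) = cis (s * cos x) * of_real (2 * cos (x / 2)) -
      cis (s * cos x) * of_real (sin x * tan (x / 4))"
      by (metis less_irrefl of_real_diff right_diff_distrib)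
  qed
  also have "\<dots> = ?c * fresnel (sqrt (2 * s)) - ?R"
  proof (intro integral_unique has_integral_diff integral_cis_cos_half assms integrable_integral
      integrable_continuous_real continuous_intros)
    show "\<forall>x\<in>{0..pi}. cos (x / 4) \<noteq> 0" using pos by force
  qed simp
  finally have "of_real pi * (bessel_int 0 s + bessel_int 1 s) - ?c * ?L =
      ?c * (fresnel (sqrt (2 * s)) - ?L) - ?R" by (simp add: algebra_simps)
  then have "cmod (of_real pi * (bessel_int 0 s + bessel_int 1 s) - ?c * ?L) \<le>
      cmod (?c * (fresnel (sqrt (2 * s)) - ?L)) + cmod ?R"
    using norm_triangle_ineq4 by simp
  also have "cmod (?c * (fresnel (sqrt (2 * s)) - ?L)) \<le> 4 / sqrt (2 * s) * (10 / sqrt (2 * s))"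
    unfolding norm_mult using fresnel_asymptotic[of "sqrt (2 * s)"] assms
    by (intro mult_mono) (auto simp: norm_divide)
  also have "\<dots> = 20 / s" using assms by (simp add: real_sqrt_mult[symmetric])
  also have "cmod ?R \<le> 2 / s" using assms by (rule norm_integral_cis_cos_tan)
  finally have "cmod (of_real pi * (bessel_int 0 s + bessel_int 1 s) - ?c * ?L) \<le> 22 / s" by simp
  moreover have "?c * ?L = of_real pi * bessel_wave s"
  proof -
    have "4 / sqrt (2 * s) * (sqrt pi / 2) = pi * sqrt (2 / (pi * s))"
    proof (rule power2_eq_imp_eq)
      show "(4 / sqrt (2 * s) * (sqrt pi / 2))\<^sup>2 = (pi * sqrt (2 / (pi * s)))\<^sup>2"
        using assms by (simp add: power_mult_distrib power_divide) (simp add: field_simps power2_eq_square)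
    qed (use assms in auto)
    moreover have "cis s * cis (- pi / 4) = cis (s - pi / 4)" by (simp add: cis_mult)
    moreover have "?c * ?L = of_real (4 / sqrt (2 * s) * (sqrt pi / 2)) * (cis s * cis (- pi / 4))"
      by simp
    ultimately show ?thesis by (simp only: bessel_wave_def of_real_mult mult.assoc)
  qed
  ultimately have "cmod (of_real pi * (bessel_int 0 s + bessel_int 1 s - bessel_wave s)) \<le> 22 / s"
    by (simp add: right_diff_distrib)
  then have "pi * cmod (bessel_int 0 s + bessel_int 1 s - bessel_wave s) \<le> 22 / s"
    by (simp add: norm_mult)
  moreover have "3 * cmod (bessel_int 0 s + bessel_int 1 s - bessel_wave s) \<le>
      pi * cmod (bessel_int 0 s + bessel_int 1 s - bessel_wave s)"
    using pi_gt3 by (intro mult_right_mono) auto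
  \<comment> \<open>Of the 22, 20 comes from the Fresnel error and 2 from \<open>?R\<close>;
    rounding up to 24 lets \<open>pi > 3\<close> give the constant 8.\<close>
  ultimately have "3 * cmod (bessel_int 0 s + bessel_int 1 s - bessel_wave s) \<le> 24 / s"
    using assms by (smt (verit) divide_right_mono)
  then show ?thesis by simp
qed

text \<open>Induction in steps of two by \<open>bessel_int_rec\<close>, which leaves the parity,
  hence the approximating wave, unchanged. A step costs at most \<open>2 (k + 1) / s\<close> because
  \<open>bessel_int\<close> is bounded by 1, and \<open>(k + 2)^2\<close> exceeds \<open>k^2\<close>
  by more than \<open>2 (k + 1)\<close>. The orders 0 and 1 are half the sum and half the difference
  of \<open>G\<close> and its conjugate.\<close>

lemma bessel_int_asymptotic:
  assumes s: "s > 0"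
  shows "cmod (bessel_int m s - (bessel_wave s + (- 1) ^ m * cnj (bessel_wave s)) / 2) \<le> (8 + (real m)\<^sup>2) / s"
proof (induction m rule: less_induct)
  case (less m)
  define G where "G = bessel_int 0 s + bessel_int 1 s"
  have cnjG: "cnj G = bessel_int 0 s - bessel_int 1 s"
    using cnj_bessel_int[of 0 s] cnj_bessel_int[of 1 s] by (simp add: G_def)
  have G: "cmod (G - bessel_wave s) \<le> 8 / s"
    using bessel_int_0_1_asymptotic[OF s] by (simp add: G_def)
  then have cG: "cmod (cnj G - cnj (bessel_wave s)) \<le> 8 / s"
    by (metis complex_cnj_diff complex_mod_cnj)
  consider "m = 0" | "m = 1" | k where "m = k + 2"
    by (metis One_nat_def Suc_1 add.commute less_2_cases_iff less_imp_add_positive linorder_not_less le_iff_add)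
  then show ?case
  proof cases
    case 1
    have "bessel_int m s - (bessel_wave s + (- 1) ^ m * cnj (bessel_wave s)) / 2 =
        ((G - bessel_wave s) + (cnj G - cnj (bessel_wave s))) / 2"
      unfolding cnjG using 1 by (simp add: G_def field_simps)
    also have "cmod \<dots> \<le> (8 / s + 8 / s) / 2"
      unfolding norm_divide using norm_triangle_mono[OF G cG] by simp
    finally show ?thesis using 1 by simp
  next
    case 2
    have "bessel_int m s - (bessel_wave s + (- 1) ^ m * cnj (bessel_wave s)) / 2 =
        ((G - bessel_wave s) - (cnj G - cnj (bessel_wave s))) / 2"
      unfolding cnjG using 2 by (simp add: G_def field_simps)
    also have "cmod \<dots> \<le> (8 / s + 8 / s) / 2"
      unfolding norm_divide
      using norm_triangle_ineq4[of "G - bessel_wave s" "cnj G - cnj (bessel_wave s)"] G cG by simp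
    also have "\<dots> \<le> (8 + (real m)\<^sup>2) / s" using s by (simp add: divide_right_mono)
    finally show ?thesis .
  next
    case 3
    have "bessel_int m s - (bessel_wave s + (- 1) ^ m * cnj (bessel_wave s)) / 2 =
      (bessel_int k s - (bessel_wave s + (- 1) ^ k * cnj (bessel_wave s)) / 2) -
       2 * of_nat (k + 1) / (\<i> * of_real s) * bessel_int (k + 1) s"
      unfolding bessel_int_rec[OF less_imp_neq[OF s, THEN not_sym], symmetric] using 3 by simp
    also have "cmod \<dots> \<le> (8 + (real k)\<^sup>2) / s + 2 * (k + 1) / s * 1"
    proof (rule order_trans[OF norm_triangle_ineq4 add_mono])
      show "cmod (bessel_int k s - (bessel_wave s + (- 1) ^ k * cnj (bessel_wave s)) / 2) \<le> (8 + (real k)\<^sup>2) / s"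
        using 3 by (intro less.IH) simp
      have "cmod (2 * of_nat (k + 1) / (\<i> * of_real s)) = 2 * (k + 1) / s"
        unfolding norm_mult norm_divide norm_of_nat using s by simp
      then show "cmod (2 * of_nat (k + 1) / (\<i> * of_real s) * bessel_int (k + 1) s) \<le> 2 * (k + 1) / s * 1"
        unfolding norm_mult using s norm_bessel_int_le[of "k + 1" s] by (intro mult_mono) auto
    qed
    also have "\<dots> = (8 + (real k)\<^sup>2 + 2 * (real k + 1)) / s" by (simp add: add_divide_distrib)
    also have "\<dots> \<le> (8 + (real m)\<^sup>2) / s"
      using s 3 by (intro divide_right_mono) (auto simp: power2_eq_square algebra_simps)
    finally show ?thesis .
  qed
qed

section \<open>Walks on the tree\<close>

lemma bounded_linear_ell2_fun: "bounded_linear (\<lambda>f. ell2_fun f v)"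
  by (rule bounded_linear_intro[where K = 1])
     (simp_all add: plus_ell2.rep_eq scaleR_ell2.rep_eq cmod_ell2_fun_le_norm)

lemma norm_Ell2_le_infsum:
  assumes "(\<lambda>v. cmod (f v)) summable_on UNIV"
  shows "norm (Ell2 f) \<le> (\<Sum>\<^sub>\<infinity>v. cmod (f v))"
proof (rule square_summableI(2))
  fix F :: "'a set" assume F: "finite F"
  have "(\<Sum>x\<in>F. (cmod (f x))\<^sup>2) \<le> (\<Sum>x\<in>F. cmod (f x) * (\<Sum>y\<in>F. cmod (f y)))"
    unfolding power2_eq_square using F
    by (intro sum_mono mult_left_mono) (auto intro: member_le_sum)
  also have "\<dots> = (\<Sum>y\<in>F. cmod (f y))\<^sup>2"
    by (simp add: sum_distrib_right power2_eq_square)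
  also have "\<dots> \<le> (\<Sum>\<^sub>\<infinity>v. cmod (f v))\<^sup>2"
    using F assms by (intro power_mono finite_sum_le_infsum) (auto intro: sum_nonneg)
  finally show "(\<Sum>x\<in>F. (cmod (f x))\<^sup>2) \<le> (\<Sum>\<^sub>\<infinity>v. cmod (f v))\<^sup>2" .
qed (rule infsum_nonneg, simp)

text \<open>When a walk returns to a visited vertex, the path is cut at that earlier occurrence. The
  clause on \<open>set xs\<close> will exclude a deleted vertex from paths along
  \<open>avoiding\<close>.\<close>

lemma rtranclp_imp_distinct_path:
  assumes "r\<^sup>*\<^sup>* a b"
  shows "\<exists>xs. xs \<noteq> [] \<and> hd xs = a \<and> last xs = b \<and> distinct xs \<and> successively r xs \<and>
    set xs \<subseteq> insert a {z. \<exists>y. r y z}"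
  using assms
proof (induction rule: rtranclp_induct)
  case base
  show ?case by (rule exI[of _ "[a]"]) simp
next
  case (step y z)
  then obtain xs where xs: "xs \<noteq> []" "hd xs = a" "last xs = y" "distinct xs" "successively r xs"
    "set xs \<subseteq> insert a {z. \<exists>y. r y z}" by blast
  show ?case
  proof (cases "z \<in> set xs")
    case True
    then obtain ys zs where "xs = ys @ z # zs" by (auto dest: split_list)
    with xs have "ys @ [z] \<noteq> [] \<and> hd (ys @ [z]) = a \<and> last (ys @ [z]) = z \<and> distinct (ys @ [z]) \<and>
      successively r (ys @ [z]) \<and> set (ys @ [z]) \<subseteq> insert a {z. \<exists>y. r y z}"
      by (auto simp: successively_append_iff hd_append)
    then show ?thesis by blast
  next
    case False
    with xs step.hyps have "xs @ [z] \<noteq> [] \<and> hd (xs @ [z]) = a \<and> last (xs @ [z]) = z \<and> distinct (xs @ [z]) \<and>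
      successively r (xs @ [z]) \<and> set (xs @ [z]) \<subseteq> insert a {z. \<exists>y. r y z}"
      by (auto simp: successively_append_iff)
    then show ?thesis by blast
  qed
qed

context regular_tree
begin

section \<open>Distances and branches in the tree\<close>

lemma relpowp_graph_dist: "(E ^^ graph_dist E v w) v w"
  unfolding graph_dist_def
  using rtranclp_imp_relpowp[OF connected[of v w]] by (rule LeastI_ex)

lemma graph_dist_le: "(E ^^ n) v w \<Longrightarrow> graph_dist E v w \<le> n"
  unfolding graph_dist_def by (rule Least_le)

lemma graph_dist_eq_0_iff [simp]: "graph_dist E v w = 0 \<longleftrightarrow> v = w"
  using relpowp_graph_dist[of v w] graph_dist_le[of 0 v w] by auto

lemma graph_dist_self [simp]: "graph_dist E v v = 0"
  by simp

lemma graph_dist_adj_le: "E v u \<Longrightarrow> graph_dist E v w \<le> Suc (graph_dist E u w)"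
  by (rule graph_dist_le, rule relpowp_Suc_I2) (auto intro: relpowp_graph_dist)

lemma ex_closer_nbr:
  assumes "graph_dist E v w = Suc n"
  obtains u where "E v u" "graph_dist E u w = n"
proof -
  from relpowp_graph_dist[of v w] obtain u where u: "E v u" "(E ^^ n) u w"
    unfolding assms by (metis relpowp_Suc_D2)
  from graph_dist_le[OF u(2)] graph_dist_adj_le[OF u(1), of w] assms have "graph_dist E u w = n" by simp
  with u(1) show thesis by (rule that)
qed

text \<open>The edges that remain when the vertex \<open>v\<close> is deleted; among the other
  vertices, its reflexive transitive closure describes the branches at \<open>v\<close>.\<close>

definition avoiding :: "'v \<Rightarrow> 'v \<Rightarrow> 'v \<Rightarrow> bool" where
  "avoiding v x y \<longleftrightarrow> E x y \<and> x \<noteq> v \<and> y \<noteq> v"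

lemma avoiding_rtranclp_sym: "(avoiding v)\<^sup>*\<^sup>* x y \<Longrightarrow> (avoiding v)\<^sup>*\<^sup>* y x"
  by (rule sympD[OF symp_rtranclp]) (auto simp: symp_def avoiding_def adj_sym)

text \<open>Along a geodesic from \<open>u\<close> to \<open>w\<close> the distance to
  \<open>w\<close> decreases, so the farther vertex \<open>v\<close> is never met.\<close>

lemma avoiding_rtranclp_closer:
  assumes "graph_dist E u w < graph_dist E v w"
  shows "(avoiding v)\<^sup>*\<^sup>* u w"
  using assms
proof (induction "graph_dist E u w" arbitrary: u)
  case 0
  then show ?case by (metis graph_dist_eq_0_iff rtranclp.rtrancl_refl)
next
  case (Suc n)
  obtain u' where u': "E u u'" "graph_dist E u' w = n"
    using ex_closer_nbr[of u w n] Suc.hyps(2) by metis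
  have "(avoiding v)\<^sup>*\<^sup>* u' w" using u' Suc by simp
  moreover have "avoiding v u u'" using u' Suc by (auto simp: avoiding_def)
  ultimately show ?case by (rule converse_rtranclp_into_rtranclp[rotated])
qed

text \<open>A path between two distinct neighbours that misses \<open>v\<close> would close up
  through \<open>v\<close> to a cycle.\<close>

lemma nbrs_separated:
  assumes "E v u1" "E v u2" "(avoiding v)\<^sup>*\<^sup>* u1 u2"
  shows "u1 = u2"
proof (rule ccontr)
  assume neq: "u1 \<noteq> u2"
  obtain xs where xs: "xs \<noteq> []" "hd xs = u1" "last xs = u2" "distinct xs" "successively (avoiding v) xs"
    "set xs \<subseteq> insert u1 {z. \<exists>y. avoiding v y z}"
    using rtranclp_imp_distinct_path[OF assms(3)] by blast
  have "v \<notin> set xs" using xs(6) adj_irrefl[of v] assms(1) by (auto simp: avoiding_def)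
  moreover have "length xs \<ge> 2"
    using xs(1-3) neq by (cases xs rule: remdups_adj.cases) auto
  moreover have "successively E xs"
    using xs(5) by (rule successively_mono) (auto simp: avoiding_def)
  ultimately have "graph_cycle E (v # xs)"
    using xs assms adj_sym[OF assms(2)] by (auto simp: graph_cycle_def successively_Cons)
  then show False using acyclic by blast
qed

text \<open>With equal distances, geodesics to \<open>w\<close> would connect \<open>u\<close> to a
  closer neighbour \<open>v'\<close> of \<open>v\<close> without meeting \<open>v\<close>. By
  \<open>nbrs_separated\<close> the two coincide, although their distances to \<open>w\<close>
  differ.\<close>

lemma graph_dist_adj_neq:
  assumes "E v u"
  shows "graph_dist E u w \<noteq> graph_dist E v w"
proof
  assume eq: "graph_dist E u w = graph_dist E v w"
  show False
  proof (cases "graph_dist E v w")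
    case 0
    with eq have "u = v" by (metis graph_dist_eq_0_iff)
    then show ?thesis using assms adj_irrefl by blast
  next
    case (Suc n)
    obtain v' where v': "E v v'" "graph_dist E v' w = n" using ex_closer_nbr[OF Suc] .
    obtain u' where u': "E u u'" "graph_dist E u' w = n" using ex_closer_nbr[of u w n] eq Suc by metis
    have "(avoiding v)\<^sup>*\<^sup>* u' w" "(avoiding v)\<^sup>*\<^sup>* w v'"
      using avoiding_rtranclp_closer[of u' w v] avoiding_rtranclp_closer[of v' w v] u' v' Suc
      by (auto intro: avoiding_rtranclp_sym)
    moreover have "avoiding v u u'"
      using u' Suc assms adj_irrefl by (auto simp: avoiding_def)
    ultimately have "(avoiding v)\<^sup>*\<^sup>* u v'"
      by (meson converse_rtranclp_into_rtranclp rtranclp_trans)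
    then have "u = v'" using assms v'(1) by (intro nbrs_separated)
    then show False using v' eq Suc by simp
  qed
qed

lemma closer_nbr_unique:
  assumes "E v u1" "E v u2" "graph_dist E u1 w < graph_dist E v w" "graph_dist E u2 w < graph_dist E v w"
  shows "u1 = u2"
  using assms avoiding_rtranclp_closer avoiding_rtranclp_sym
  by (intro nbrs_separated[of v]) (blast intro: rtranclp_trans)+

lemma sum_nbrs_at_root:
  "(\<Sum>u | E w u. g (graph_dist E u w)) = of_nat (q + 1) * (g 1 :: 'a :: comm_ring_1)"
proof -
  have "graph_dist E u w = 1" if "E w u" for u
  proof -
    have "graph_dist E u w \<le> Suc (graph_dist E w w)" using that adj_sym by (intro graph_dist_adj_le) auto
    moreover have "graph_dist E u w \<noteq> 0" using that adj_irrefl by auto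
    moreover have "graph_dist E w w = 0" by simp
    ultimately show ?thesis by linarith
  qed
  then have "(\<Sum>u | E w u. g (graph_dist E u w)) = (\<Sum>u | E w u. g 1)" by (intro sum.cong) auto
  then show ?thesis by (simp add: card_nbrs)
qed

text \<open>Exactly one neighbour is closer to \<open>w\<close> and the other \<open>q\<close> are
  one step farther. Hence the adjacency operator preserves radial functions about \<open>w\<close>,
  and the problem becomes a recursion in the distance.\<close>

lemma sum_nbrs_off_root:
  assumes d: "graph_dist E v w = Suc n"
  shows "(\<Sum>u | E v u. g (graph_dist E u w)) = g n + of_nat q * (g (n + 2) :: 'a :: comm_ring_1)"
proof -
  obtain u0 where u0: "E v u0" "graph_dist E u0 w = n" using ex_closer_nbr[OF d] .
  have far: "graph_dist E u w = n + 2" if "u \<in> {u. E v u} - {u0}" for u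
  proof -
    have "graph_dist E u w \<le> Suc (graph_dist E v w)" using that adj_sym by (intro graph_dist_adj_le) auto
    moreover have "graph_dist E u w \<noteq> graph_dist E v w" using that graph_dist_adj_neq by auto
    moreover have "\<not> graph_dist E u w < graph_dist E v w"
      using closer_nbr_unique[of v u u0 w] that u0 d by auto
    ultimately show ?thesis using d by linarith
  qed
  have "(\<Sum>u | E v u. g (graph_dist E u w)) =
      g (graph_dist E u0 w) + (\<Sum>u\<in>{u. E v u} - {u0}. g (graph_dist E u w))"
    using u0 finite_nbrs by (intro sum.remove) auto
  also have "(\<Sum>u\<in>{u. E v u} - {u0}. g (graph_dist E u w)) = (\<Sum>u\<in>{u. E v u} - {u0}. g (n + 2))"
    using far by (intro sum.cong) auto
  also have "\<dots> = of_nat q * g (n + 2)"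
    using u0 finite_nbrs by (simp add: card_nbrs card_Diff_singleton)
  finally show ?thesis using u0 by simp
qed

end

text \<open>The number of walks of length \<open>j\<close> between two vertices at distance
  \<open>n\<close>, obtained by summing over the first step.\<close>

fun tree_walks :: "nat \<Rightarrow> nat \<Rightarrow> nat \<Rightarrow> nat" where
  "tree_walks q 0 n = (if n = 0 then 1 else 0)"
| "tree_walks q (Suc j) 0 = (q + 1) * tree_walks q j 1"
| "tree_walks q (Suc j) (Suc n) = tree_walks q j n + q * tree_walks q j (n + 2)"

context regular_tree
begin

text \<open>Operators are represented as real-linear maps, so the complex factor \<open>c\<close> is
  carried through the induction. The case \<open>c = 1\<close> yields the kernel; general
  \<open>c\<close> is needed for complex combinations of point masses.\<close>

lemma evolution_power_delta:
  "ell2_fun (((((o\<^sub>L) (scaleC_op z o\<^sub>L adjacency_op E)) ^^ j) id_blinfun) (scaleC_ell2 c (delta_ell2 w))) v =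
    c * (z ^ j * of_nat (tree_walks q j (graph_dist E v w)))"
proof (induction j arbitrary: v)
  case 0
  show ?case by (simp add: scaleC_ell2.rep_eq delta_ell2.rep_eq)
next
  case (Suc j)
  have "ell2_fun (((((o\<^sub>L) (scaleC_op z o\<^sub>L adjacency_op E)) ^^ Suc j) id_blinfun) (scaleC_ell2 c (delta_ell2 w))) v
     = z * (\<Sum>u | E v u. c * (z ^ j * of_nat (tree_walks q j (graph_dist E u w))))"
    by (simp add: scaleC_op.rep_eq scaleC_ell2.rep_eq adjacency_op_apply Suc)
  also have "\<dots> = c * (z ^ Suc j * (\<Sum>u | E v u. of_nat (tree_walks q j (graph_dist E u w))))"
    by (simp add: sum_distrib_left mult_ac)
  also have "(\<Sum>u | E v u. of_nat (tree_walks q j (graph_dist E u w)) :: complex) =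
      of_nat (tree_walks q (Suc j) (graph_dist E v w))"
  proof (cases "graph_dist E v w")
    case 0
    then have "v = w" by simp
    then show ?thesis
      using sum_nbrs_at_root[of "\<lambda>n. of_nat (tree_walks q j n) :: complex" w]
      by (simp add: distrib_right)
  next
    case (Suc n)
    with sum_nbrs_off_root[OF Suc, of "\<lambda>n. of_nat (tree_walks q j n) :: complex"] show ?thesis by simp
  qed
  finally show ?case .
qed

lemma evolution_delta_sums:
  "(\<lambda>j. c * ((\<i> * of_real t) ^ j * of_nat (tree_walks q j (graph_dist E v w)) / fact j)) sums
    ell2_fun (evolution E t (scaleC_ell2 c (delta_ell2 w))) v"
proof -
  let ?T = "scaleC_op (\<i> * of_real t) o\<^sub>L adjacency_op E"
  have "bounded_linear (\<lambda>X. ell2_fun (blinfun_apply X (scaleC_ell2 c (delta_ell2 w))) v)"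
    by (rule bounded_linear_compose[OF bounded_linear_ell2_fun blinfun.bounded_linear_left])
  from bounded_linear.sums[OF this summable_sums[OF summable_exp_blinfun[of ?T]]]
  have "(\<lambda>j. ell2_fun (blinfun_apply ((((o\<^sub>L) ?T) ^^ j) id_blinfun /\<^sub>R fact j) (scaleC_ell2 c (delta_ell2 w))) v) sums
    ell2_fun (evolution E t (scaleC_ell2 c (delta_ell2 w))) v"
    by (simp add: evolution_def exp_blinfun_def)
  then show ?thesis
    by (simp add: blinfun.scaleR_left scaleR_ell2.rep_eq evolution_power_delta scaleR_conv_of_real field_simps)
qed

lemma evolution_kernel_sums:
  "(\<lambda>j. (\<i> * of_real t) ^ j * of_nat (tree_walks q j (graph_dist E v w)) / fact j) sums evolution_kernel E t v w"
proof -
  have "scaleC_ell2 1 (delta_ell2 w) = delta_ell2 w" by transfer simp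
  then show ?thesis
    using evolution_delta_sums[of 1 t v w] by (simp add: evolution_kernel_def cinner_delta_ell2)
qed

lemma evolution_scaleC_delta:
  "ell2_fun (evolution E t (scaleC_ell2 c (delta_ell2 w))) v = c * evolution_kernel E t v w"
  by (rule sums_unique2[OF evolution_delta_sums sums_mult[OF evolution_kernel_sums]])

end

section \<open>Spectral representation of the kernel\<close>

lemma sums_integral_dominated:
  fixes f :: "nat \<Rightarrow> real \<Rightarrow> 'a :: banach"
  assumes cont: "\<And>k. continuous_on {a..b} (f k)"
    and le: "\<And>k x. x \<in> {a..b} \<Longrightarrow> norm (f k x) \<le> M k" and M: "summable M"
  shows "(\<lambda>k. integral {a..b} (f k)) sums integral {a..b} (\<lambda>x. \<Sum>k. f k x)"
    and "continuous_on {a..b} (\<lambda>x. \<Sum>k. f k x)"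
proof -
  have lim: "uniform_limit {a..b} (\<lambda>n x. \<Sum>k<n. f k x) (\<lambda>x. \<Sum>k. f k x) sequentially"
    using le M by (rule Weierstrass_m_test)
  have contn: "continuous_on {a..b} (\<lambda>x. \<Sum>k<n. f k x)" for n
    by (intro continuous_intros cont)
  show "continuous_on {a..b} (\<lambda>x. \<Sum>k. f k x)"
    by (rule uniform_limit_theorem[OF _ lim]) (auto intro!: always_eventually contn)
  obtain I J where IJ: "\<And>n. ((\<lambda>x. \<Sum>k<n. f k x) has_integral I n) {a..b}"
    "((\<lambda>x. \<Sum>k. f k x) has_integral J) {a..b}" "I \<longlonglongrightarrow> J"
    using uniform_limit_integral[OF lim contn] by auto
  have "I n = (\<Sum>k<n. integral {a..b} (f k))" for n
    using IJ(1) by (rule has_integral_unique) (intro has_integral_sum integrable_integral integrable_continuous_real cont, simp)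
  then have "I = (\<lambda>n. \<Sum>k<n. integral {a..b} (f k))" ..
  then show "(\<lambda>k. integral {a..b} (f k)) sums integral {a..b} (\<lambda>x. \<Sum>k. f k x)"
    using IJ(3) integral_unique[OF IJ(2)] by (simp add: sums_def)
qed

text \<open>Up to the factor \<open>2 sin x q\<^bsup>-n/2\<^esup> / pi\<close> this is the spherical function of the tree times its
  Plancherel density, at the spectral parameter \<open>2 sqrt q cos x\<close>.\<close>

definition tree_profile :: "nat \<Rightarrow> nat \<Rightarrow> real \<Rightarrow> real" where
  "tree_profile q n x = (\<Sum>k. (1 / real q) ^ k * sin (real (n + 1 + 2 * k) * x))"

lemma tree_profile_term_le: "norm ((1 / real q) ^ k * sin (real m * x)) \<le> (1 / real q) ^ k"
  by (simp add: abs_mult mult_left_le)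

lemma summable_inverse_power: "q \<ge> 2 \<Longrightarrow> summable (\<lambda>k. (1 / real q) ^ k)"
  by (rule summable_geometric) simp

lemma tree_profile_sums:
  assumes "q \<ge> 2"
  shows "(\<lambda>k. (1 / real q) ^ k * sin (real (n + 1 + 2 * k) * x)) sums tree_profile q n x"
  unfolding tree_profile_def
  by (rule summable_sums, rule summable_comparison_test'[OF summable_inverse_power[OF assms]])
     (rule tree_profile_term_le)

lemma continuous_tree_profile:
  assumes "q \<ge> 2"
  shows "continuous_on {0..pi} (tree_profile q n)"
  unfolding tree_profile_def[abs_def]
  by (rule sums_integral_dominated(2)[OF _ tree_profile_term_le summable_inverse_power[OF assms]])
     (intro continuous_intros)

text \<open>The addition formula for \<open>sin\<close>, applied to every term, shifts the frequency
  down and up by one.\<close>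

lemma tree_profile_rec:
  assumes "q \<ge> 2"
  shows "2 * cos x * tree_profile q (Suc n) x = tree_profile q n x + tree_profile q (n + 2) x"
proof -
  have eq: "2 * cos x * sin (real (Suc n + 1 + 2 * k) * x) =
      sin (real (n + 1 + 2 * k) * x) + sin (real (n + 2 + 1 + 2 * k) * x)" for k
    using sin_add[of "real (Suc n + 1 + 2 * k) * x" x] sin_diff[of "real (Suc n + 1 + 2 * k) * x" x]
    by (simp add: algebra_simps)
  have "(\<lambda>k. 2 * cos x * ((1 / real q) ^ k * sin (real (Suc n + 1 + 2 * k) * x))) sums
      (2 * cos x * tree_profile q (Suc n) x)"
    by (intro sums_mult tree_profile_sums assms)
  also have "(\<lambda>k. 2 * cos x * ((1 / real q) ^ k * sin (real (Suc n + 1 + 2 * k) * x))) =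
    (\<lambda>k. (1 / real q) ^ k * sin (real (n + 1 + 2 * k) * x) + (1 / real q) ^ k * sin (real (n + 2 + 1 + 2 * k) * x))"
    using eq by (simp only: distrib_left[symmetric] mult.left_commute[of "2 * cos x"])
  finally show ?thesis
    by (rule sums_unique2[OF _ sums_add[OF tree_profile_sums[OF assms] tree_profile_sums[OF assms]]])
qed

text \<open>Here the series with lowered frequencies starts with \<open>sin 0 = 0\<close>. Shifting
  its index by one turns it into \<open>1 / q\<close> times \<open>tree_profile q 1\<close>, which
  produces the special factor at the root.\<close>

lemma tree_profile_rec_0:
  assumes "q \<ge> 2"
  shows "2 * cos x * tree_profile q 0 x = (1 + 1 / real q) * tree_profile q 1 x"
proof -
  have eq: "2 * cos x * sin (real (0 + 1 + 2 * k) * x) =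
      sin (real (2 * k) * x) + sin (real (1 + 1 + 2 * k) * x)" for k
    using sin_add[of "real (0 + 1 + 2 * k) * x" x] sin_diff[of "real (0 + 1 + 2 * k) * x" x]
    by (simp add: algebra_simps)
  have "(\<lambda>k. (1 / real q) * ((1 / real q) ^ k * sin (real (1 + 1 + 2 * k) * x))) sums (1 / real q * tree_profile q 1 x)"
    by (intro sums_mult tree_profile_sums assms)
  also have "(\<lambda>k. (1 / real q) * ((1 / real q) ^ k * sin (real (1 + 1 + 2 * k) * x))) =
      (\<lambda>k. (1 / real q) ^ Suc k * sin (real (2 * Suc k) * x))"
    by (simp add: mult.assoc add.commute)
  finally have "(\<lambda>k. (1 / real q) ^ k * sin (real (2 * k) * x)) sums
      (1 / real q * tree_profile q 1 x + (1 / real q) ^ 0 * sin (real (2 * 0) * x))"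
    by (rule sums_Suc)
  then have low: "(\<lambda>k. (1 / real q) ^ k * sin (real (2 * k) * x)) sums (1 / real q * tree_profile q 1 x)"
    by simp
  have "(\<lambda>k. 2 * cos x * ((1 / real q) ^ k * sin (real (0 + 1 + 2 * k) * x))) sums
      (2 * cos x * tree_profile q 0 x)"
    by (intro sums_mult tree_profile_sums assms)
  also have "(\<lambda>k. 2 * cos x * ((1 / real q) ^ k * sin (real (0 + 1 + 2 * k) * x))) =
    (\<lambda>k. (1 / real q) ^ k * sin (real (2 * k) * x) + (1 / real q) ^ k * sin (real (1 + 1 + 2 * k) * x))"
    using eq by (simp only: distrib_left[symmetric] mult.left_commute[of "2 * cos x"])
  finally have "2 * cos x * tree_profile q 0 x = 1 / real q * tree_profile q 1 x + tree_profile q 1 x"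
    by (rule sums_unique2[OF _ sums_add[OF low tree_profile_sums[OF assms]]])
  then show ?thesis by (simp add: distrib_right)
qed

section \<open>Moments of the spectral density\<close>

lemma has_integral_cos_nat: "((\<lambda>x. cos (real n * x)) has_integral (if n = 0 then pi else 0)) {0..pi}"
proof (cases "n = 0")
  case True
  then show ?thesis using has_integral_const_real[of "1::real" 0 pi] by simp
next
  case False
  have "((\<lambda>x. cos (real n * x)) has_integral sin (real n * pi) / n - sin (real n * 0) / n) {0..pi}"
    by (rule fundamental_theorem_of_calculus)
       (use False in \<open>auto intro!: derivative_eq_intros simp flip: has_real_derivative_iff_has_vector_derivative\<close>)
  then show ?thesis using False by (simp add: sin_npi)
qed

lemma has_integral_sin_sin_Suc:
  "((\<lambda>x. 2 * sin x * sin (real (m + 1) * x)) has_integral (if m = 0 then pi else 0)) {0..pi}"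
proof -
  have "2 * sin x * sin (real (m + 1) * x) = cos (real m * x) - cos (real (m + 2) * x)" for x
    using cos_add[of "real (m + 1) * x" x] cos_diff[of "real (m + 1) * x" x]
    by (simp add: algebra_simps)
  then show ?thesis
    using has_integral_diff[OF has_integral_cos_nat[of m] has_integral_cos_nat[of "m + 2"]] by simp
qed

text \<open>In the spectral variable, \<open>2 * cos x\<close> represents the adjacency operator
  divided by \<open>sqrt q\<close>; these moments are the walk counts up to powers of
  \<open>sqrt q\<close>.\<close>

definition tree_moment :: "nat \<Rightarrow> nat \<Rightarrow> nat \<Rightarrow> real" where
  "tree_moment q j n = integral {0..pi} (\<lambda>x. (2 * cos x) ^ j * (2 * sin x * tree_profile q n x)) / pi"

lemma tree_moment_integrable:
  "q \<ge> 2 \<Longrightarrow> (\<lambda>x. (2 * cos x) ^ j * (2 * sin x * tree_profile q n x)) integrable_on {0..pi}"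
  by (intro integrable_continuous_real continuous_intros continuous_tree_profile)

text \<open>By orthogonality only the frequency \<open>n + 1 + 2 * k = 1\<close> pairs with
  \<open>sin x\<close>, that is \<open>n = k = 0\<close>. This matches the walks of length
  0.\<close>

lemma tree_moment_0:
  assumes "q \<ge> 2"
  shows "tree_moment q 0 n = (if n = 0 then 1 else 0)"
proof -
  define f where "f k x = 2 * sin x * ((1 / real q) ^ k * sin (real (n + 1 + 2 * k) * x))" for k x
  have sums: "(\<lambda>k. integral {0..pi} (f k)) sums integral {0..pi} (\<lambda>x. \<Sum>k. f k x)"
  proof (rule sums_integral_dominated(1))
    show "summable (\<lambda>k. 2 * (1 / real q) ^ k)"
      by (intro summable_mult summable_inverse_power assms)
    fix k and x :: real
    have "norm (2 * sin x) \<le> 2" using abs_sin_le_one[of x] by (simp add: abs_mult)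
    then have "norm (f k x) \<le> 2 * norm ((1 / real q) ^ k * sin (real (n + 1 + 2 * k) * x))"
      unfolding f_def norm_mult[of "2 * sin x"] by (intro mult_right_mono) auto
    also have "\<dots> \<le> 2 * (1 / real q) ^ k"
      by (intro mult_left_mono tree_profile_term_le) simp
    finally show "norm (f k x) \<le> 2 * (1 / real q) ^ k" .
  qed (auto simp: f_def intro!: continuous_intros)
  have int_eq: "integral {0..pi} (f k) = (if k = 0 then if n = 0 then pi else 0 else 0)" for k
  proof -
    have "((\<lambda>x. (1 / real q) ^ k * (2 * sin x * sin (real (n + 2 * k + 1) * x))) has_integral
        (1 / real q) ^ k * (if n + 2 * k = 0 then pi else 0)) {0..pi}"
      by (intro has_integral_mult_right has_integral_sin_sin_Suc)
    moreover have "(\<lambda>x. (1 / real q) ^ k * (2 * sin x * sin (real (n + 2 * k + 1) * x))) = f k"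
      by (simp add: f_def fun_eq_iff mult_ac add_ac)
    ultimately have "integral {0..pi} (f k) = (1 / real q) ^ k * (if n + 2 * k = 0 then pi else 0)"
      by (simp add: integral_unique)
    then show ?thesis by simp
  qed
  have "(\<Sum>k. f k x) = 2 * sin x * tree_profile q n x" for x
    unfolding f_def by (rule sums_unique[symmetric], intro sums_mult tree_profile_sums assms)
  with sums have "(\<lambda>k. if k = 0 then if n = 0 then pi else 0 else 0) sums
      integral {0..pi} (\<lambda>x. 2 * sin x * tree_profile q n x)"
    by (simp only: int_eq)
  then have "integral {0..pi} (\<lambda>x. 2 * sin x * tree_profile q n x) = (if n = 0 then pi else 0)"
    by (rule sums_unique2) (rule sums_single)
  then show ?thesis by (simp add: tree_moment_def)
qed

lemma tree_moment_Suc: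
  assumes "q \<ge> 2"
  shows "tree_moment q (Suc j) (Suc n) = tree_moment q j n + tree_moment q j (n + 2)"
proof -
  have "(2 * cos x) ^ Suc j * (2 * sin x * tree_profile q (Suc n) x) =
      (2 * cos x) ^ j * (2 * sin x * (2 * cos x * tree_profile q (Suc n) x))" for x
    by (simp add: mult_ac)
  then have "(2 * cos x) ^ Suc j * (2 * sin x * tree_profile q (Suc n) x) =
      (2 * cos x) ^ j * (2 * sin x * tree_profile q n x) + (2 * cos x) ^ j * (2 * sin x * tree_profile q (n + 2) x)" for x
    unfolding tree_profile_rec[OF assms] by (simp only: distrib_left)
  then show ?thesis
    unfolding tree_moment_def add_divide_distrib[symmetric]
    by (simp only: integral_add[OF tree_moment_integrable tree_moment_integrable, OF assms assms])
qed

lemma tree_moment_Suc_0: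
  assumes "q \<ge> 2"
  shows "tree_moment q (Suc j) 0 = (1 + 1 / real q) * tree_moment q j 1"
proof -
  have "(2 * cos x) ^ Suc j * (2 * sin x * tree_profile q 0 x) =
      (2 * cos x) ^ j * (2 * sin x * (2 * cos x * tree_profile q 0 x))" for x
    by (simp add: mult_ac)
  then have "(2 * cos x) ^ Suc j * (2 * sin x * tree_profile q 0 x) =
      (1 + 1 / real q) * ((2 * cos x) ^ j * (2 * sin x * tree_profile q 1 x))" for x
    unfolding tree_profile_rec_0[OF assms] by (simp only: mult_ac)
  then show ?thesis
    unfolding tree_moment_def by (simp only: integral_mult_right times_divide_eq_right)
qed

text \<open>Both sides obey the same recursion: the factor \<open>sqrt q ^ n\<close> in the
  denominator absorbs the \<open>q\<close> farther neighbours and makes the moment recursion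
  symmetric.\<close>

lemma tree_walks_eq_moment:
  assumes "q \<ge> 2"
  shows "real (tree_walks q j n) = sqrt q ^ j / sqrt q ^ n * tree_moment q j n"
  using assms
proof (induction q j n rule: tree_walks.induct)
  case (1 q n)
  then show ?case by (simp add: tree_moment_0)
next
  case (2 q j)
  define p where "p = sqrt (real q)"
  have p: "p \<noteq> 0" "real q = p * p" using 2 by (auto simp: p_def)
  have "real (tree_walks q (Suc j) 0) = (p * p + 1) * (p ^ j / p * tree_moment q j 1)"
    using 2 by (simp flip: p_def p(2)) (simp add: p_def distrib_right add_divide_distrib)
  also have "\<dots> = p ^ Suc j * ((1 + 1 / (p * p)) * tree_moment q j 1)"
    using p(1) by (simp add: field_simps)
  finally show ?case
    unfolding p_def[symmetric] unfolding tree_moment_Suc_0[OF 2(2)] p(2)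
    by (simp only: power_0 div_by_1)
next
  case (3 q j n)
  define p where "p = sqrt (real q)"
  have p: "p \<noteq> 0" "real q = p * p" using 3 by (auto simp: p_def)
  have "real (tree_walks q (Suc j) (Suc n)) =
      p ^ j / p ^ n * tree_moment q j n + (p * p) * (p ^ j / p ^ (n + 2) * tree_moment q j (n + 2))"
    using 3 by (simp only: tree_walks.simps of_nat_add of_nat_mult p_def p(2)[unfolded p_def, symmetric])
  also have "\<dots> = p ^ Suc j / p ^ Suc n * (tree_moment q j n + tree_moment q j (n + 2))"
    using p(1) by (simp add: field_simps)
  finally show ?case
    unfolding tree_moment_Suc[OF 3(3)] p_def[symmetric] .
qed

lemma tree_walks_exp_sums:
  fixes t :: real and q n :: nat
  assumes "q \<ge> 2"
  shows "(\<lambda>j. (\<i> * of_real t) ^ j * of_nat (tree_walks q j n) / fact j) sums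
    (integral {0..pi} (\<lambda>x. cis (2 * sqrt q * t * cos x) * of_real (2 * sin x * tree_profile q n x)) / of_real (pi * sqrt q ^ n))"
proof -
  define s where "s = sqrt q * t"
  define h where "h x = 2 * sin x * tree_profile q n x" for x
  have conth: "continuous_on {0..pi} h"
    unfolding h_def by (intro continuous_intros continuous_tree_profile assms)
  define f where "f j x = (\<i> * of_real (s * (2 * cos x))) ^ j /\<^sub>R fact j * of_real (h x)" for j x
  \<comment> \<open>A bound on \<open>h\<close> gives an exponential series as majorant, so that sum
    and integral may be exchanged.\<close>
  have "compact (h ` {0..pi})" by (intro compact_continuous_image conth) simp
  then have "bounded (h ` {0..pi})" by (rule compact_imp_bounded)
  then obtain B where "\<forall>y\<in>h ` {0..pi}. norm y \<le> B" using bounded_iff by blast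
  then have B: "\<bar>h x\<bar> \<le> B" if "x \<in> {0..pi}" for x using that by auto
  have B0: "B \<ge> 0" using B[of 0] by simp
  have "(\<lambda>j. integral {0..pi} (f j)) sums integral {0..pi} (\<lambda>x. \<Sum>j. f j x)"
  proof (rule sums_integral_dominated(1))
    show "summable (\<lambda>j. (2 * \<bar>s\<bar>) ^ j /\<^sub>R fact j * B)"
      by (intro summable_mult2 summable_exp_generic)
    fix j and x :: real assume x: "x \<in> {0..pi}"
    have "\<bar>s * (2 * cos x)\<bar> \<le> 2 * \<bar>s\<bar>" by (simp add: abs_mult mult_left_le)
    then have "\<bar>s * (2 * cos x)\<bar> ^ j \<le> (2 * \<bar>s\<bar>) ^ j" by (intro power_mono) auto
    then have "\<bar>s * (2 * cos x)\<bar> ^ j /\<^sub>R fact j * \<bar>h x\<bar> \<le> (2 * \<bar>s\<bar>) ^ j /\<^sub>R fact j * B"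
      using B[OF x] B0 by (intro mult_mono) (auto intro: divide_right_mono simp: field_simps)
    moreover have "norm (f j x) = \<bar>s * (2 * cos x)\<bar> ^ j /\<^sub>R fact j * \<bar>h x\<bar>"
      unfolding f_def norm_mult norm_scaleR norm_power norm_of_real by simp
    ultimately show "norm (f j x) \<le> (2 * \<bar>s\<bar>) ^ j /\<^sub>R fact j * B" by simp
  qed (auto simp: f_def intro!: continuous_intros conth)
  moreover have "(\<Sum>j. f j x) = cis (2 * sqrt q * t * cos x) * of_real (h x)" for x
  proof -
    have "(\<lambda>j. f j x) sums (exp (\<i> * of_real (s * (2 * cos x))) * of_real (h x))"
      unfolding f_def by (intro sums_mult2 exp_converges)
    moreover have "exp (\<i> * of_real (s * (2 * cos x))) = cis (2 * sqrt q * t * cos x)"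
      by (simp add: cis_conv_exp s_def mult_ac)
    ultimately show ?thesis by (simp add: sums_iff)
  qed
  ultimately have "(\<lambda>j. integral {0..pi} (f j) / of_real (pi * sqrt q ^ n)) sums
      (integral {0..pi} (\<lambda>x. cis (2 * sqrt q * t * cos x) * of_real (h x)) / of_real (pi * sqrt q ^ n))"
    by (intro sums_divide) simp
  moreover have "integral {0..pi} (f j) / of_real (pi * sqrt q ^ n) =
      (\<i> * of_real t) ^ j * of_nat (tree_walks q j n) / fact j" for j
  proof -
    have f_eq: "f j = (\<lambda>x. (\<i> * of_real s) ^ j / fact j * of_real ((2 * cos x) ^ j * h x))"
      by (simp add: fun_eq_iff f_def scaleR_conv_of_real power_mult_distrib field_simps)
    have "integral {0..pi} (f j) = (\<i> * of_real s) ^ j / fact j *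
        integral {0..pi} (\<lambda>x. of_real ((2 * cos x) ^ j * h x))"
      unfolding f_eq by (rule integral_mult_right)
    also have "integral {0..pi} (\<lambda>x. complex_of_real ((2 * cos x) ^ j * h x)) = of_real (pi * tree_moment q j n)"
      using has_integral_linear[OF integrable_integral[OF tree_moment_integrable[OF assms]] bounded_linear_of_real]
      unfolding tree_moment_def h_def by (intro integral_unique) (simp add: o_def)
    also have "pi * tree_moment q j n = pi * sqrt q ^ n / sqrt q ^ j * real (tree_walks q j n)"
      using assms by (simp add: tree_walks_eq_moment)
    finally show ?thesis
      using assms by (simp add: s_def power_mult_distrib field_simps)
  qed
  ultimately show ?thesis by (simp add: h_def)
qed

text \<open>Expanding the profile and integrating each term by parts produces the Bessel functions
  together with the decisive factor \<open>1 / s\<close>; the interchange is dominated by a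
  geometric series.\<close>

lemma tree_profile_integral_sums:
  fixes s :: real and q n :: nat
  assumes q: "q \<ge> 2" and s: "s \<noteq> 0"
  shows "(\<lambda>k. of_real ((1 / real q) ^ k) * (2 * of_nat (n + 1 + 2 * k) / (\<i> * of_real s) * bessel_int (n + 1 + 2 * k) s)) sums
    (integral {0..pi} (\<lambda>x. cis (s * cos x) * of_real (2 * sin x * tree_profile q n x)) / of_real pi)"
proof -
  define f where "f k x = cis (s * cos x) * of_real (2 * sin x * ((1 / real q) ^ k * sin (real (n + 1 + 2 * k) * x)))" for k x
  have "(\<lambda>k. integral {0..pi} (f k)) sums integral {0..pi} (\<lambda>x. \<Sum>k. f k x)"
  proof (rule sums_integral_dominated(1))
    show "summable (\<lambda>k. 2 * (1 / real q) ^ k)"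
      by (intro summable_mult summable_inverse_power q)
    fix k and x :: real
    have "norm (2 * sin x) \<le> 2" using abs_sin_le_one[of x] by (simp add: abs_mult)
    then have "norm (f k x) \<le> 2 * norm ((1 / real q) ^ k * sin (real (n + 1 + 2 * k) * x))"
      unfolding f_def norm_mult[of "cis _"] norm_of_real real_norm_def[symmetric] norm_cis mult_1 norm_mult[of "2 * sin x"]
      by (intro mult_right_mono) auto
    also have "\<dots> \<le> 2 * (1 / real q) ^ k"
      by (intro mult_left_mono tree_profile_term_le) simp
    finally show "norm (f k x) \<le> 2 * (1 / real q) ^ k" .
  qed (auto simp: f_def intro!: continuous_intros)
  moreover have "(\<Sum>k. f k x) = cis (s * cos x) * of_real (2 * sin x * tree_profile q n x)" for x
    unfolding f_def
    by (rule sums_unique[symmetric], intro sums_mult sums_of_real tree_profile_sums q)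
  ultimately have "(\<lambda>k. integral {0..pi} (f k) / of_real pi) sums
     (integral {0..pi} (\<lambda>x. cis (s * cos x) * of_real (2 * sin x * tree_profile q n x)) / of_real pi)"
    by (intro sums_divide) simp
  moreover have "integral {0..pi} (f k) / of_real pi =
    of_real ((1 / real q) ^ k) * (2 * of_nat (n + 1 + 2 * k) / (\<i> * of_real s) * bessel_int (n + 1 + 2 * k) s)" for k
  proof -
    have f_eq: "f k = (\<lambda>x. of_real ((1 / real q) ^ k) *
        (cis (s * cos x) * of_real (2 * sin x * sin (real (n + 1 + 2 * k) * x))))"
      by (simp add: f_def fun_eq_iff)
    show ?thesis
      unfolding integral_sin_sin_cis_cos[OF s, symmetric] f_eq integral_mult_right by simp
  qed
  ultimately show ?thesis by simp
qed

lemma (in regular_tree) evolution_kernel_bessel_sums: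
  assumes q: "q \<ge> 2" and t: "t > 0" and n: "graph_dist E v w = n"
  defines "s \<equiv> 2 * sqrt q * t"
  shows "(\<lambda>k. of_real ((1 / sqrt q) ^ (n + 2 * k)) *
      (2 * of_nat (n + 2 * k + 1) / (\<i> * of_real s) * bessel_int (n + 2 * k + 1) s)) sums evolution_kernel E t v w"
proof -
  have s: "s \<noteq> 0" using q t by (simp add: s_def)
  let ?I = "integral {0..pi} (\<lambda>x. cis (s * cos x) * of_real (2 * sin x * tree_profile q n x))"
  have "evolution_kernel E t v w = of_real ((1 / sqrt q) ^ n) * (?I / of_real pi)"
    using sums_unique2[OF evolution_kernel_sums[of t v w, unfolded n] tree_walks_exp_sums[OF q]]
    by (simp add: s_def power_divide)
  moreover have "of_real ((1 / sqrt q) ^ n) * (of_real ((1 / real q) ^ k) *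
      (2 * of_nat (n + 1 + 2 * k) / (\<i> * of_real s) * bessel_int (n + 1 + 2 * k) s)) =
     of_real ((1 / sqrt q) ^ (n + 2 * k)) *
      (2 * of_nat (n + 2 * k + 1) / (\<i> * of_real s) * bessel_int (n + 2 * k + 1) s)" for k
  proof -
    have "(1 / sqrt q) ^ n * (1 / real q) ^ k = (1 / sqrt q) ^ (n + 2 * k)"
      using q by (simp add: power_add power_mult power_divide)
    moreover have "n + 1 + 2 * k = n + 2 * k + 1" by simp
    ultimately show ?thesis
      unfolding mult.assoc[symmetric] of_real_mult[symmetric] by (simp only:)
  qed
  ultimately show ?thesis
    using sums_mult[OF tree_profile_integral_sums[OF q s, of n], of "of_real ((1 / sqrt q) ^ n)"]
    by (simp only:)
qed

section \<open>Dispersive estimates\<close>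

text \<open>Bounding a subseries of \<open>g\<close> by the full series removes the dependence on
  the reindexing \<open>h\<close>; with \<open>h k = n + 2 * k\<close> this gives uniformity in
  \<open>n\<close>.\<close>

lemma norm_sums_le_reindex:
  fixes a :: "nat \<Rightarrow> 'a :: real_normed_vector"
  assumes sums: "a sums L" and le: "\<And>k. norm (a k) \<le> g (h k)" and inj: "inj h"
    and g: "summable g" "\<And>j. g j \<ge> 0"
  shows "norm L \<le> suminf g"
proof (rule LIMSEQ_le_const2)
  show "(\<lambda>N. norm (\<Sum>k<N. a k)) \<longlonglongrightarrow> norm L"
    using sums unfolding sums_def by (rule tendsto_norm)
  have "norm (\<Sum>k<N. a k) \<le> suminf g" for N
  proof -
    have "norm (\<Sum>k<N. a k) \<le> (\<Sum>k<N. g (h k))"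
      by (rule sum_norm_le) (rule le)
    also have "\<dots> = sum g (h ` {..<N})"
      using inj by (subst sum.reindex) (auto intro: inj_on_subset simp: o_def)
    also have "\<dots> \<le> suminf g" by (rule sum_le_suminf) (use g in auto)
    finally show ?thesis .
  qed
  then show "\<exists>M. \<forall>N\<ge>M. norm (\<Sum>k<N. a k) \<le> suminf g" by blast
qed

text \<open>The coefficients are those of the geometric series differentiated three times.\<close>

lemma summable_cubic_power:
  fixes r :: real
  assumes "norm r < 1"
  shows "summable (\<lambda>j. real ((j + 1) * (j + 2) * (j + 3)) * r ^ j)"
proof -
  have 0: "summable (\<lambda>j. 1 * x ^ j)" if "norm x < 1" for x :: real
    using summable_geometric[OF that] by simp
  have 1: "summable (\<lambda>j. diffs (\<lambda>_. 1) j * x ^ j)" if "norm x < 1" for x :: real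
    using that 0 by (rule termdiff_converges)
  have 2: "summable (\<lambda>j. diffs (diffs (\<lambda>_. 1)) j * x ^ j)" if "norm x < 1" for x :: real
    using that 1 by (rule termdiff_converges)
  have "summable (\<lambda>j. diffs (diffs (diffs (\<lambda>_. 1))) j * r ^ j)"
    using assms 2 by (rule termdiff_converges)
  moreover have "diffs (diffs (diffs (\<lambda>_. 1 :: real))) j = real ((j + 1) * (j + 2) * (j + 3))" for j
    by (simp add: diffs_def algebra_simps)
  ultimately show ?thesis by (simp only:)
qed

text \<open>The index \<open>j = n + 2 * k\<close> of the series for the kernel enters the estimates only through
  this majorant, which makes them uniform in \<open>n\<close>.\<close>

definition cubic_bound :: "nat \<Rightarrow> nat \<Rightarrow> real" where
  "cubic_bound q j = real ((j + 1) * (j + 2) * (j + 3)) * (1 / sqrt q) ^ j"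

lemma summable_cubic_bound: "q \<ge> 2 \<Longrightarrow> summable (cubic_bound q)"
  unfolding cubic_bound_def[abs_def] by (rule summable_cubic_power) simp

lemma cubic_bound_nonneg: "cubic_bound q j \<ge> 0"
  by (simp add: cubic_bound_def)

text \<open>The 9 is the 8 of \<open>bessel_int_asymptotic\<close> plus 1 for the size of the
  leading wave, so that the same majorant serves the asymptotics and the decay estimate.\<close>

lemma quadratic_le_cubic_bound:
  "(1 / sqrt q) ^ j * (2 * real (j + 1) * (9 + (real (j + 1))\<^sup>2)) \<le> 4 * cubic_bound q j"
proof -
  have "9 + (real (j + 1))\<^sup>2 \<le> 2 * (real (j + 2) * real (j + 3))"
    by (simp add: power2_eq_square algebra_simps)
  then have "2 * real (j + 1) * (9 + (real (j + 1))\<^sup>2) \<le> 2 * real (j + 1) * (2 * (real (j + 2) * real (j + 3)))"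
    by (rule mult_left_mono) simp
  also have "\<dots> = 4 * real ((j + 1) * (j + 2) * (j + 3))" by (simp add: algebra_simps)
  finally have "(1 / sqrt q) ^ j * (2 * real (j + 1) * (9 + (real (j + 1))\<^sup>2)) \<le>
      (1 / sqrt q) ^ j * (4 * real ((j + 1) * (j + 2) * (j + 3)))"
    by (rule mult_left_mono) simp
  then show ?thesis by (simp only: cubic_bound_def mult_ac)
qed

text \<open>Splitting \<open>n + 2 k + 1\<close> as \<open>(n - 1) + 2 (k + 1)\<close> reduces the
  sum to the geometric series in \<open>1 / q\<close> and its derivative. The value is the source of
  the amplitude in the theorem.\<close>

lemma tree_weight_sums:
  assumes "q \<ge> 2"
  shows "(\<lambda>k. (1 / sqrt q) ^ (n + 2 * k) * real (n + 2 * k + 1)) sums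
    ((1 / sqrt q) ^ n * (real q * (2 + (real n + 1) * (real q - 1)) / (real q - 1)\<^sup>2))"
proof -
  define x where "x = 1 / real q"
  have x: "norm x < 1" using assms by (simp add: x_def)
  have "(\<lambda>k. (1 / sqrt q) ^ n * ((real n - 1) * x ^ k + 2 * (of_nat (Suc k) * x ^ k))) sums
      ((1 / sqrt q) ^ n * ((real n - 1) * (1 / (1 - x)) + 2 * (1 / (1 - x)\<^sup>2)))"
    by (intro sums_mult sums_add geometric_sums geometric_deriv_sums x)
  moreover have "(1 / sqrt q) ^ n * ((real n - 1) * x ^ k + 2 * (of_nat (Suc k) * x ^ k)) =
      (1 / sqrt q) ^ (n + 2 * k) * real (n + 2 * k + 1)" for k
  proof -
    have "(1 / sqrt q) ^ (n + 2 * k) = (1 / sqrt q) ^ n * x ^ k"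
      by (simp add: x_def power_add power_mult power_divide)
    then show ?thesis by (simp add: algebra_simps)
  qed
  moreover have "(real n - 1) * (1 / (1 - x)) + 2 * (1 / (1 - x)\<^sup>2) =
      real q * (2 + (real n + 1) * (real q - 1)) / (real q - 1)\<^sup>2"
  proof -
    have "real q \<noteq> 0" "real q - 1 \<noteq> 0" using assms by auto
    then show ?thesis
      unfolding x_def by (simp add: divide_simps) (simp add: power2_eq_square algebra_simps)
  qed
  ultimately show ?thesis by simp
qed

lemma wave_amplitude:
  assumes q: "q \<ge> 2" and t: "t > 0"
  shows "2 / (2 * sqrt q * t) * sqrt (2 / (pi * (2 * sqrt q * t))) *
      ((1 / sqrt q) ^ n * (real q * c / d)) =
    1 / (sqrt pi * t powr (3 / 2)) * (real q powr (- real n / 2 + 1 / 4) * c / d)"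
proof -
  \<comment> \<open>In terms of this root, \<open>sqrt q\<close> and \<open>q\<close> are integral
    powers, and only \<open>u\<close> itself survives next to \<open>q\<close> to the power
    \<open>- n / 2\<close>.\<close>
  define u where "u = real q powr (1 / 4)"
  have u: "u > 0" using q by (simp add: u_def)
  have sqrtq: "sqrt q = u * u"
    using q by (simp add: u_def powr_half_sqrt[symmetric] flip: powr_add)
  have q4: "real q = u * u * (u * u)"
    using sqrtq by (metis of_nat_0_le_iff real_sqrt_mult_self abs_of_nonneg)
  have "real q powr (- real n / 2 + 1 / 4) = real q powr (- (1 / 2) * real n) * u"
    unfolding u_def powr_add[symmetric] by simp
  also have "real q powr (- (1 / 2) * real n) = (real q powr (- (1 / 2))) ^ n"
    using q by (simp add: powr_power mult.commute)
  also have "real q powr (- (1 / 2)) = 1 / sqrt q"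
    by (simp add: powr_minus powr_half_sqrt inverse_eq_divide)
  finally have 1: "real q powr (- real n / 2 + 1 / 4) = (1 / sqrt q) ^ n * u" .
  have "t powr (3 / 2) = t powr (1 + 1 / 2)" by simp
  also have "\<dots> = t * sqrt t" using t by (simp only: powr_add powr_half_sqrt powr_one less_imp_le)
  finally have 2: "t powr (3 / 2) = t * sqrt t" .
  have "2 / (pi * (2 * sqrt q * t)) = 1 / (pi * (u * u * t))" by (simp add: sqrtq)
  moreover have "sqrt (1 / (pi * (u * u * t))) = 1 / (sqrt pi * (u * sqrt t))"
    using u by (simp add: real_sqrt_divide real_sqrt_mult)
  ultimately have 3: "sqrt (2 / (pi * (2 * sqrt q * t))) = 1 / (sqrt pi * (u * sqrt t))"
    by (simp only:)
  have main: "2 / (2 * sqrt q * t) * (1 / (sqrt pi * (u * sqrt t))) * real q = 1 / (sqrt pi * (t * sqrt t)) * u"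
    unfolding sqrtq unfolding q4 using u t by (simp add: field_simps)
  have regroup: "x * y * (r * (p * c / d)) = x * y * p * (r * c / d)" for x y r p :: real
    by simp
  show ?thesis
    unfolding 1 2 3 regroup main by simp
qed

lemma bessel_wave_parity:
  "(bessel_wave s + (- 1) ^ m * cnj (bessel_wave s)) / 2 =
    (if even m then of_real (sqrt (2 / (pi * s)) * cos (s - pi / 4))
     else \<i> * of_real (sqrt (2 / (pi * s)) * sin (s - pi / 4)))"
  by (auto simp: bessel_wave_def complex_eq_iff)

lemma norm_bessel_wave_parity_le:
  assumes "s > 0"
  shows "cmod ((bessel_wave s + (- 1) ^ m * cnj (bessel_wave s)) / 2) \<le> 1 / sqrt s"
proof -
  have "cmod ((bessel_wave s + (- 1) ^ m * cnj (bessel_wave s)) / 2) \<le>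
      (cmod (bessel_wave s) + cmod ((- 1) ^ m * cnj (bessel_wave s))) / 2"
    unfolding norm_divide using norm_triangle_ineq by (simp add: divide_right_mono)
  also have "\<dots> = sqrt (2 / (pi * s))"
    using assms by (simp add: norm_mult norm_power bessel_wave_def)
  also have "\<dots> \<le> sqrt (1 / s)"
    using assms pi_ge_two by (intro real_sqrt_le_mono) (simp add: field_simps)
  finally show ?thesis by (simp add: real_sqrt_divide)
qed

section \<open>Uniform asymptotics and decay of the kernel\<close>

context regular_tree
begin

text \<open>All orders \<open>n + 2 k + 1\<close> have the same parity, so one wave factors out of
  the whole series and the weights are summed by \<open>tree_weight_sums\<close>. The error in each
  term is \<open>O(1 / s)\<close>, multiplied by the prefactor \<open>1 / s\<close>.\<close>

lemma evolution_kernel_asymptotic: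
  assumes q: "q \<ge> 2" and t: "t > 0" and n: "graph_dist E v w = n"
  shows "cmod (evolution_kernel E t v w -
      2 / (\<i> * of_real (2 * sqrt q * t)) *
      ((bessel_wave (2 * sqrt q * t) + (- 1) ^ (n + 1) * cnj (bessel_wave (2 * sqrt q * t))) / 2) *
      of_real ((1 / sqrt q) ^ n * (real q * (2 + (real n + 1) * (real q - 1)) / (real q - 1)\<^sup>2)))
    \<le> 4 * suminf (cubic_bound q) / (2 * sqrt q * t)\<^sup>2"
proof -
  define s where "s = 2 * sqrt q * t"
  have s: "s > 0" using q t by (simp add: s_def)
  define W where "W = (bessel_wave s + (- 1) ^ (n + 1) * cnj (bessel_wave s)) / 2"
  define a where "a k = of_real ((1 / sqrt q) ^ (n + 2 * k)) *
      (2 * of_nat (n + 2 * k + 1) / (\<i> * of_real s) * bessel_int (n + 2 * k + 1) s)" for k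
  have 1: "a sums evolution_kernel E t v w"
    unfolding a_def s_def by (rule evolution_kernel_bessel_sums[OF q t n])
  have 2: "(\<lambda>k. 2 / (\<i> * of_real s) * W * of_real ((1 / sqrt q) ^ (n + 2 * k) * real (n + 2 * k + 1))) sums
     (2 / (\<i> * of_real s) * W * of_real ((1 / sqrt q) ^ n * (real q * (2 + (real n + 1) * (real q - 1)) / (real q - 1)\<^sup>2)))"
    by (intro sums_mult sums_of_real tree_weight_sums q)
  have "cmod (a k - 2 / (\<i> * of_real s) * W * of_real ((1 / sqrt q) ^ (n + 2 * k) * real (n + 2 * k + 1)))
      \<le> 4 / s\<^sup>2 * cubic_bound q (n + 2 * k)" for k
  proof -
    define j where "j = n + 2 * k"
    have W: "W = (bessel_wave s + (- 1) ^ (j + 1) * cnj (bessel_wave s)) / 2"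
      by (simp add: W_def j_def power_add)
    have factor: "r * (2 * m / d * G) - 2 / d * V * (r * m) = r * (2 * m / d) * (G - V)"
      for r m d G V :: complex by (simp add: right_diff_distrib diff_divide_distrib mult_ac)
    have "a k - 2 / (\<i> * of_real s) * W * of_real ((1 / sqrt q) ^ j * real (j + 1)) =
        of_real ((1 / sqrt q) ^ j) * (2 * of_nat (j + 1) / (\<i> * of_real s)) * (bessel_int (j + 1) s - W)"
      unfolding a_def j_def[symmetric] of_real_mult of_real_of_nat_eq by (rule factor)
    also have "cmod \<dots> = (1 / sqrt q) ^ j * (2 * real (j + 1) / s) * cmod (bessel_int (j + 1) s - W)"
      unfolding norm_mult norm_divide norm_of_real norm_of_nat using s by simp
    also have "\<dots> \<le> (1 / sqrt q) ^ j * (2 * real (j + 1) / s) * ((9 + (real (j + 1))\<^sup>2) / s)"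
    proof (rule mult_left_mono)
      have "cmod (bessel_int (j + 1) s - W) \<le> (8 + (real (j + 1))\<^sup>2) / s"
        unfolding W by (rule bessel_int_asymptotic[OF s])
      also have "\<dots> \<le> (9 + (real (j + 1))\<^sup>2) / s" using s by (intro divide_right_mono) auto
      finally show "cmod (bessel_int (j + 1) s - W) \<le> (9 + (real (j + 1))\<^sup>2) / s" .
    qed (use s in simp)
    also have "\<dots> = 1 / s\<^sup>2 * ((1 / sqrt q) ^ j * (2 * real (j + 1) * (9 + (real (j + 1))\<^sup>2)))"
      by (simp add: power2_eq_square)
    also have "\<dots> \<le> 1 / s\<^sup>2 * (4 * cubic_bound q j)"
      by (intro mult_left_mono quadratic_le_cubic_bound) simp
    finally show ?thesis by (simp add: j_def)
  qed
  then have "cmod (evolution_kernel E t v w - 2 / (\<i> * of_real s) * W *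
      of_real ((1 / sqrt q) ^ n * (real q * (2 + (real n + 1) * (real q - 1)) / (real q - 1)\<^sup>2)))
    \<le> (\<Sum>j. 4 / s\<^sup>2 * cubic_bound q j)"
    by (rule norm_sums_le_reindex[OF sums_diff[OF 1 2]])
      (auto intro!: injI summable_mult summable_cubic_bound q divide_nonneg_nonneg
        mult_nonneg_nonneg cubic_bound_nonneg)
  also have "\<dots> = 4 / s\<^sup>2 * suminf (cubic_bound q)"
    by (rule suminf_mult[OF summable_cubic_bound[OF q]])
  also have "\<dots> = 4 * suminf (cubic_bound q) / s\<^sup>2" by simp
  finally show ?thesis by (simp only: s_def W_def)
qed

text \<open>The Bessel series is estimated termwise: wave and error are both
  \<open>O(1 / sqrt s)\<close> because \<open>s >= 1\<close>, and the prefactor supplies another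
  \<open>1 / s\<close>. Finally \<open>s >= t\<close> replaces \<open>s\<close> by
  \<open>t\<close>.\<close>

lemma norm_evolution_kernel_le:
  assumes q: "q \<ge> 2" and t: "t \<ge> 1"
  shows "cmod (evolution_kernel E t v w) \<le> 4 * suminf (cubic_bound q) / t powr (3 / 2)"
proof -
  define s where "s = 2 * sqrt q * t"
  have "sqrt q \<ge> 1" using q by simp
  then have "1 * t \<le> 2 * sqrt q * t" using t by (intro mult_right_mono) linarith+
  then have st: "s \<ge> t" by (simp add: s_def)
  then have s: "s \<ge> 1" using t by simp
  have sq: "sqrt s \<le> s" using s by (intro real_le_lsqrt) (auto simp: power2_eq_square intro: mult_left_le)
  obtain n where n: "graph_dist E v w = n" by simp
  define a where "a k = of_real ((1 / sqrt q) ^ (n + 2 * k)) *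
      (2 * of_nat (n + 2 * k + 1) / (\<i> * of_real s) * bessel_int (n + 2 * k + 1) s)" for k
  have 1: "a sums evolution_kernel E t v w"
    unfolding a_def s_def by (rule evolution_kernel_bessel_sums[OF q _ n]) (use t in simp)
  have "cmod (a k) \<le> 4 / (s * sqrt s) * cubic_bound q (n + 2 * k)" for k
  proof -
    define j where "j = n + 2 * k"
    define W where "W = (bessel_wave s + (- 1) ^ (j + 1) * cnj (bessel_wave s)) / 2"
    have "cmod (bessel_int (j + 1) s) \<le> cmod (bessel_int (j + 1) s - W) + cmod W"
      using norm_triangle_sub by (metis add.commute)
    also have "\<dots> \<le> (8 + (real (j + 1))\<^sup>2) / s + 1 / sqrt s"
      unfolding W_def using s by (intro add_mono bessel_int_asymptotic norm_bessel_wave_parity_le) auto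
    also have "\<dots> \<le> (8 + (real (j + 1))\<^sup>2) / sqrt s + 1 / sqrt s"
      using s sq by (intro add_mono divide_left_mono) auto
    also have "\<dots> = (9 + (real (j + 1))\<^sup>2) / sqrt s" by (simp add: add_divide_distrib)
    finally have le: "cmod (bessel_int (j + 1) s) \<le> (9 + (real (j + 1))\<^sup>2) / sqrt s" .
    have "cmod (a k) = (1 / sqrt q) ^ j * (2 * real (j + 1) / s) * cmod (bessel_int (j + 1) s)"
      unfolding a_def j_def[symmetric] norm_mult norm_divide norm_of_real norm_of_nat using s by simp
    also have "\<dots> \<le> (1 / sqrt q) ^ j * (2 * real (j + 1) / s) * ((9 + (real (j + 1))\<^sup>2) / sqrt s)"
      using s by (intro mult_left_mono le) simp
    also have "\<dots> = 1 / (s * sqrt s) * ((1 / sqrt q) ^ j * (2 * real (j + 1) * (9 + (real (j + 1))\<^sup>2)))"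
      by simp
    also have "\<dots> \<le> 1 / (s * sqrt s) * (4 * cubic_bound q j)"
      using s by (intro mult_left_mono quadratic_le_cubic_bound) simp
    finally show ?thesis by (simp add: j_def)
  qed
  then have "cmod (evolution_kernel E t v w) \<le> (\<Sum>j. 4 / (s * sqrt s) * cubic_bound q j)"
    by (rule norm_sums_le_reindex[OF 1])
      (use s in \<open>auto intro!: injI summable_mult summable_cubic_bound q divide_nonneg_nonneg
          mult_nonneg_nonneg cubic_bound_nonneg\<close>)
  also have "\<dots> = 4 / (s * sqrt s) * suminf (cubic_bound q)"
    by (rule suminf_mult[OF summable_cubic_bound[OF q]])
  also have "\<dots> = 4 * suminf (cubic_bound q) / (s * sqrt s)" by simp
  also have "\<dots> \<le> 4 * suminf (cubic_bound q) / (t * sqrt t)"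
    using t st
    by (intro divide_left_mono mult_mono mult_pos_pos mult_nonneg_nonneg suminf_nonneg
        summable_cubic_bound q cubic_bound_nonneg) auto
  also have "t * sqrt t = t powr (1 + 1 / 2)"
    using t by (simp only: powr_add powr_half_sqrt powr_one)
  finally show ?thesis by simp
qed

text \<open>The kernel bound applies directly to the finite combination \<open>fF\<close> of point
  masses. The rest \<open>g\<close> is small in the summable norm, hence in the Hilbert space norm,
  and there boundedness of the operator suffices.\<close>

lemma norm_evolution_le_norm_one:
  assumes K: "\<And>w. cmod (evolution_kernel E t v w) \<le> B"
    and f: "(\<lambda>w. cmod (f w)) summable_on UNIV"
  shows "cmod (ell2_fun (evolution E t (Ell2 f)) v) \<le> B * norm_one f"
proof (rule field_le_epsilon)
  fix e :: real assume e: "e > 0"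
  \<comment> \<open>Adding 1 makes \<open>N\<close> positive, so that \<open>e / N\<close> is a
    legitimate accuracy even if the operator norm were 0.\<close>
  define N where "N = norm (evolution E t) + 1"
  have N: "N > 0" "norm (evolution E t) \<le> N" by (auto simp: N_def add_nonneg_pos)
  have "((\<lambda>w. cmod (f w)) has_sum norm_one f) UNIV"
    using f unfolding norm_one_def by (rule has_sum_infsum)
  from has_sum_finite_approximation[OF this, of "e / N"]
  obtain F where F: "finite F" "dist (\<Sum>w\<in>F. cmod (f w)) (norm_one f) \<le> e / N"
    using e N by auto
  define fF where "fF = (\<Sum>w\<in>F. scaleC_ell2 (f w) (delta_ell2 w))"
  define g where "g w = (if w \<in> F then 0 else f w)" for w
  have "ell2_fun fF x = f x - g x" for x
  proof -
    have "ell2_fun fF x = (\<Sum>w\<in>F. f w * (if x = w then 1 else 0))"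
      unfolding fF_def linear_sum[OF bounded_linear.linear[OF bounded_linear_ell2_fun]]
      by (simp add: scaleC_ell2.rep_eq delta_ell2.rep_eq)
    also have "\<dots> = (\<Sum>w\<in>F. if x = w then f w else 0)" by (intro sum.cong) auto
    also have "\<dots> = f x - g x" using F(1) by (simp add: g_def)
    finally show ?thesis .
  qed
  have "(\<lambda>w. cmod (f w)) summable_on (- F)" by (rule summable_on_subset_banach[OF f]) simp
  moreover have "(\<lambda>w. cmod (f w)) summable_on (- F) \<longleftrightarrow> (\<lambda>w. cmod (g w)) summable_on UNIV"
    by (rule summable_on_cong_neutral) (auto simp: g_def)
  ultimately have g: "(\<lambda>w. cmod (g w)) summable_on UNIV" by simp
  have fss: "square_summable f" by (rule abs_summable_imp_square_summable[OF f])
  have gss: "square_summable g" by (rule abs_summable_imp_square_summable[OF g])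
  have split: "Ell2 f = fF + Ell2 g"
    by (rule ell2_fun_inject[THEN iffD1])
       (simp add: plus_ell2.rep_eq ell2_fun_Ell2 fss gss \<open>\<And>x. ell2_fun fF x = f x - g x\<close>)
  have "(\<Sum>\<^sub>\<infinity>w. cmod (g w)) = (\<Sum>\<^sub>\<infinity>w\<in>- F. cmod (f w))"
    by (rule infsum_cong_neutral) (auto simp: g_def)
  also have "\<dots> = norm_one f - (\<Sum>w\<in>F. cmod (f w))"
    unfolding norm_one_def Compl_eq_Diff_UNIV
    using F(1) f by (subst infsum_Diff) auto
  also have "\<dots> \<le> e / N" using F(2) by (simp add: dist_real_def)
  finally have gN: "norm (Ell2 g) \<le> e / N"
    using norm_Ell2_le_infsum[OF g] by simp
  have "cmod (ell2_fun (evolution E t (Ell2 g)) v) \<le> norm (evolution E t (Ell2 g))"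
    by (rule cmod_ell2_fun_le_norm)
  also have "\<dots> \<le> norm (evolution E t) * norm (Ell2 g)" by (rule norm_blinfun)
  also have "\<dots> \<le> N * (e / N)" using N gN by (intro mult_mono) auto
  finally have tail: "cmod (ell2_fun (evolution E t (Ell2 g)) v) \<le> e" using N by simp
  have "ell2_fun (evolution E t fF) v = (\<Sum>w\<in>F. f w * evolution_kernel E t v w)"
    unfolding fF_def blinfun.sum_right linear_sum[OF bounded_linear.linear[OF bounded_linear_ell2_fun]]
      evolution_scaleC_delta ..
  also have "cmod \<dots> \<le> (\<Sum>w\<in>F. cmod (f w) * B)"
    by (rule sum_norm_le) (auto simp: norm_mult intro!: mult_left_mono K)
  also have "\<dots> = B * (\<Sum>w\<in>F. cmod (f w))"
    by (simp add: sum_distrib_left mult.commute)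
  also have "\<dots> \<le> B * norm_one f"
  proof (rule mult_left_mono)
    show "(\<Sum>w\<in>F. cmod (f w)) \<le> norm_one f"
      unfolding norm_one_def using F(1) f by (intro finite_sum_le_infsum) auto
    show "0 \<le> B" using order_trans[OF norm_ge_zero K] .
  qed
  finally have "cmod (ell2_fun (evolution E t fF) v) \<le> B * norm_one f" .
  moreover have "ell2_fun (evolution E t (Ell2 f)) v =
      ell2_fun (evolution E t fF) v + ell2_fun (evolution E t (Ell2 g)) v"
    unfolding split blinfun.add_right by (simp add: plus_ell2.rep_eq)
  ultimately show "cmod (ell2_fun (evolution E t (Ell2 f)) v) \<le> B * norm_one f + e"
    using norm_triangle_ineq[of "ell2_fun (evolution E t fF) v" "ell2_fun (evolution E t (Ell2 g)) v"] tail
    by simp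
qed

end

theorem theorem1p1:
  fixes q :: nat and E :: "'v \<Rightarrow> 'v \<Rightarrow> bool"
  assumes "q \<ge> 2" and "regular_tree q E"
  shows "(\<exists>C. \<forall>\<^sub>F t in at_top. \<forall>v w n. graph_dist E v w = n \<longrightarrow>
           cmod (evolution_kernel E t v w -
             (if even n
              then complex_of_real
                     (1 / (sqrt pi * t powr (3/2)) * sin (2 * sqrt q * t - pi/4)
                      * (real q powr (- real n / 2 + 1/4) * (2 + (real n + 1) * (real q - 1))
                         / (real q - 1)\<^sup>2))
              else - \<i> * complex_of_real
                     (1 / (sqrt pi * t powr (3/2)) * sin (2 * sqrt q * t + pi/4)
                      * (real q powr (- real n / 2 + 1/4) * (2 + (real n + 1) * (real q - 1))
                         / (real q - 1)\<^sup>2))))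
           \<le> C * t powr (- 2)) \<and>
         (\<exists>t0 C. \<forall>t>t0. \<forall>f :: 'v \<Rightarrow> complex. (\<lambda>v. cmod (f v)) summable_on UNIV \<longrightarrow>
           norm_sup (ell2_fun (evolution E t (Ell2 f))) \<le> C / t powr (3/2) * norm_one f)"
proof -
  interpret regular_tree q E by fact
  note q = assms(1)
  define C where "C = 4 * suminf (cubic_bound q)"
  have C: "C \<ge> 0"
    unfolding C_def by (intro mult_nonneg_nonneg suminf_nonneg summable_cubic_bound q cubic_bound_nonneg) simp
  have asym: "cmod (evolution_kernel E t v w -
             (if even n
              then complex_of_real
                     (1 / (sqrt pi * t powr (3/2)) * sin (2 * sqrt q * t - pi/4)
                      * (real q powr (- real n / 2 + 1/4) * (2 + (real n + 1) * (real q - 1))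
                         / (real q - 1)\<^sup>2))
              else - \<i> * complex_of_real
                     (1 / (sqrt pi * t powr (3/2)) * sin (2 * sqrt q * t + pi/4)
                      * (real q powr (- real n / 2 + 1/4) * (2 + (real n + 1) * (real q - 1))
                         / (real q - 1)\<^sup>2))))
           \<le> C * t powr (- 2)" (is "cmod (_ - ?rhs) \<le> _")
    if t: "t > 0" and n: "graph_dist E v w = n" for t v w n
  proof -
    define s where "s = 2 * sqrt q * t"
    define A where "A = (1 / sqrt q) ^ n * (real q * (2 + (real n + 1) * (real q - 1)) / (real q - 1)\<^sup>2)"
    define P where "P = 2 / s * sqrt (2 / (pi * s)) * A"
    have P: "P = 1 / (sqrt pi * t powr (3/2)) *
        (real q powr (- real n / 2 + 1/4) * (2 + (real n + 1) * (real q - 1)) / (real q - 1)\<^sup>2)"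
      unfolding P_def A_def s_def by (rule wave_amplitude[OF q t])
    have sin_eq: "sin (s + pi / 4) = cos (s - pi / 4)"
      by (simp add: sin_add cos_diff sin_45 cos_45)
    have rhs: "?rhs = (if even n then of_real (P * sin (s - pi / 4)) else - \<i> * of_real (P * cos (s - pi / 4)))"
      unfolding P s_def[symmetric] sin_eq by (simp only: mult_ac)
    have inv: "2 / (\<i> * of_real s) = - \<i> * of_real (2 / s)"
      using q t by (subst nonzero_divide_eq_eq) (auto simp: s_def)
    \<comment> \<open>The Bessel order \<open>n + 1\<close> has parity opposite to \<open>n\<close>.
      For even \<open>n\<close> the wave is \<open>\<i>\<close> times a sine and the factor
      \<open>- \<i>\<close> makes it real; for odd \<open>n\<close> it is a cosine and the factor
      \<open>- \<i>\<close> remains.\<close>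
    have "2 / (\<i> * of_real s) * ((bessel_wave s + (- 1) ^ (n + 1) * cnj (bessel_wave s)) / 2) * of_real A = ?rhs"
      unfolding inv bessel_wave_parity rhs P_def by (simp add: mult_ac)
    then have "cmod (evolution_kernel E t v w - ?rhs) \<le> C / s\<^sup>2"
      using evolution_kernel_asymptotic[OF q t n] unfolding C_def A_def s_def by (simp only:)
    also have "C / s\<^sup>2 \<le> C / t\<^sup>2"
    proof (rule divide_left_mono)
      have "sqrt q \<ge> 1" using q by simp
      then have "1 * t \<le> 2 * sqrt q * t" using t by (intro mult_right_mono) linarith+
      then show "t\<^sup>2 \<le> s\<^sup>2" using t unfolding s_def by (intro power_mono) auto
    qed (use C t q in \<open>auto simp: s_def\<close>)
    also have "C / t\<^sup>2 = C * t powr (- 2)"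
      using t by (simp add: powr_minus powr_numeral divide_inverse)
    finally show ?thesis .
  qed
  have disp: "norm_sup (ell2_fun (evolution E t (Ell2 f))) \<le> C / t powr (3/2) * norm_one f"
    if "t > 1" "(\<lambda>v. cmod (f v)) summable_on UNIV" for t and f :: "'v \<Rightarrow> complex"
    unfolding norm_sup_def C_def using that
    by (intro cSUP_least norm_evolution_le_norm_one norm_evolution_kernel_le q) auto
  show ?thesis
  proof (rule conjI[OF exI[of _ C] exI[of _ 1, OF exI[of _ C]]], goal_cases)
    case 1
    show ?case
      by (rule eventually_mono[OF eventually_gt_at_top[of 0]]) (intro allI impI asym, assumption+)
  next
    case 2
    show ?case using disp by blast
  qed
qed

end
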